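(* For each $m\ge1$, let $X_m=s_m+N_m$, where $X_m,s_m,N_m$ are $n_m\times p_m$ real matrices, $s_m$ is deterministic, and the columns of the random matrix $N_m$ are independent, each with a spherical distribution on $\mathbb R^{n_m}$. Let $n_m,p_m\to\infty$ as $m\to\infty$ such that $c_0\le n_m/p_m\le c_1$ for arbitrary fixed $0<c_0<c_1$. Let $\Theta_{m1}\subset\mathbb R^{n_m\times p_m}$. Consider the randomization tests of the null hypotheses $s_m=0$ with test statistics $\|X_m\|_{\mathrm{op}}$ and randomization distributions uniform over the direct product $\mathcal G_m=O(n_m)\times\dots\times O(n_m)$ of $p_m$ orthogonal groups, rotating the columns of the data. Suppose there is a sequence $(t_{m,2})_{m\ge1}$ such that with probability tending to one $\|N_m\|_{2,\infty}\le t_{m,2}$, and such that for every sequence $(s_m)_{m\ge1}$ with $s_m\in\Theta_{m1}$ for all $m\ge1$, $$\liminf_{m\to\infty}\frac{\|s_m\|_{\mathrm{op}}/(n_m^{1/2}+p_m^{1/2})}{(\|s_m\|_{2,\infty}+2t_{m,2})/n_m^{1/2}}>2.$$ Then the sequence of randomization tests is consistent against the sequence of alternatives $s_m\in\Theta_{m1}$.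
   Context: $\|M\|_{\mathrm{op}}$ is the largest singular value of $M$; $\|M\|_{2,\infty}$ is the maximum of the Euclidean norms of the columns of $M$. A random vector $N\in\mathbb R^n$ has a spherical distribution if $ON=_dN$ for every orthogonal matrix $O\in O(n)$. An element $(O_1,\dots,O_{p_m})\in\mathcal G_m$ maps the matrix with columns $x_1,\dots,x_{p_m}$ to the matrix with columns $O_1x_1,\dots,O_{p_m}x_{p_m}$. Randomization test: given a statistic $f_m$, a fixed level $\alpha\in(0,1]$, a fixed integer $K\ge1$ with $1/(K+1)\le\alpha$, and a compact group acting linearly on the data, draw $G_{m1},\dots,G_{mK}$ iid from the Haar probability measure on the group, independently of the data; let $f_{(1)}\le\dots\le f_{(K+1)}$ be the ordered values of $f_m(X_m),f_m(G_{m1}X_m),\dots,f_m(G_{mK}X_m)$ and $k=\lceil(1-\alpha)(K+1)\rceil$; reject when $f_m(X_m)>f_{(k)}$ (with $f_{(0)}=-\infty$). Consistent against $s_m\in\Theta_{m1}$ means: for every sequence $(s_m)_{m\ge1}$ with $s_m\in\Theta_{m1}$ for all $m$, the rejection probability (over the noise and the random group elements) tends to $1$ as $m\to\infty$. *)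

theory Defs
  imports
    "HOL-Probability.Probability"
    "HOL-Algebra.Product_Groups"
    "Jordan_Normal_Form.Char_Poly"
begin

text \<open>Matrix sizes depend on \<open>m\<close>, so vectors and matrices are the size-indexed ones
  of \<open>Jordan_Normal_Form\<close>.\<close>


section \<open>Norms\<close>

text \<open>The eigenvalues of \<open>A\<^sup>T A\<close> include zeros that are not counted as singular values when
  \<open>A\<close> has more columns than rows; this does not affect the largest one.
  The maxima below are over nonempty sets as soon as \<open>A\<close> has at least one column.\<close>

definition singular_values :: "real mat \<Rightarrow> real set" where
  "singular_values A = {sqrt l | l. eigenvalue (transpose_mat A * A) l}"

definition op_norm :: "real mat \<Rightarrow> real" where
  "op_norm A = Max (singular_values A)"

definition eucl_norm :: "real vec \<Rightarrow> real" where
  "eucl_norm v = L2_set (vec_index v) {..<dim_vec v}"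

definition two_inf_norm :: "real mat \<Rightarrow> real" where
  "two_inf_norm A = Max ((\<lambda>j. eucl_norm (col A j)) ` {..<dim_col A})"


section \<open>Borel structures\<close>

text \<open>The Borel \<open>\<sigma>\<close>-algebras, generated by the entries.\<close>

definition vec_borel :: "nat \<Rightarrow> real vec measure" where
  "vec_borel n = vimage_algebra (carrier_vec n)
     (\<lambda>v. \<lambda>i\<in>{..<n}. vec_index v i) (\<Pi>\<^sub>M i\<in>{..<n}. borel)"

definition mat_borel :: "nat \<Rightarrow> nat \<Rightarrow> real mat measure" where
  "mat_borel n p = vimage_algebra (carrier_mat n p)
     (\<lambda>A. \<lambda>ij\<in>{..<n} \<times> {..<p}. A $$ ij) (\<Pi>\<^sub>M ij\<in>{..<n} \<times> {..<p}. borel)"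


section \<open>Products of orthogonal groups and Haar measure\<close>

definition orthogonal_mats :: "nat \<Rightarrow> real mat set" where
  "orthogonal_mats n = {U \<in> carrier_mat n n. transpose_mat U * U = 1\<^sub>m n}"

definition orthogonal_group :: "nat \<Rightarrow> real mat monoid" where
  "orthogonal_group n = \<lparr>carrier = orthogonal_mats n, mult = (*), one = 1\<^sub>m n\<rparr>"

definition column_rotations :: "nat \<Rightarrow> nat \<Rightarrow> (nat \<Rightarrow> real mat) monoid" where
  "column_rotations n p = product_group {..<p} (\<lambda>_. orthogonal_group n)"

definition column_rotations_borel :: "nat \<Rightarrow> nat \<Rightarrow> (nat \<Rightarrow> real mat) measure" where
  "column_rotations_borel n p =
     (\<Pi>\<^sub>M j\<in>{..<p}. restrict_space (mat_borel n n) (orthogonal_mats n))"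

definition rotate_columns :: "nat \<Rightarrow> nat \<Rightarrow> (nat \<Rightarrow> real mat) \<Rightarrow> real mat \<Rightarrow> real mat" where
  "rotate_columns n p U A = mat_of_cols n (map (\<lambda>j. U j *\<^sub>v col A j) [0..<p])"

text \<open>A left-invariant probability measure on the Borel sets \<open>B\<close> of a compact group \<open>G\<close>.
  Such a measure exists and is unique; it is also right-invariant.\<close>

definition haar_prob_measure :: "('g, 'b) monoid_scheme \<Rightarrow> 'g measure \<Rightarrow> 'g measure \<Rightarrow> bool" where
  "haar_prob_measure G B \<mu> \<longleftrightarrow>
     prob_space \<mu> \<and> sets \<mu> = sets B \<and>
     (\<forall>g\<in>carrier G. distr \<mu> B (\<lambda>h. g \<otimes>\<^bsub>G\<^esub> h) = \<mu>)"


section \<open>Spherical distributions\<close>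

definition spherical :: "'w measure \<Rightarrow> nat \<Rightarrow> ('w \<Rightarrow> real vec) \<Rightarrow> bool" where
  "spherical M n Z \<longleftrightarrow>
     Z \<in> M \<rightarrow>\<^sub>M vec_borel n \<and>
     (\<forall>U\<in>orthogonal_mats n. distr M (vec_borel n) (\<lambda>\<omega>. U *\<^sub>v Z \<omega>) = distr M (vec_borel n) Z)"


section \<open>Independence\<close>

text \<open>\<^const>\<open>prob_space.indep_var\<close> requires both random variables to have the same type; this is
  the same notion, stated through the generated \<open>\<sigma>\<close>-algebras, for values of different types.\<close>

definition indep_rvs ::
  "'w measure \<Rightarrow> 'a measure \<Rightarrow> ('w \<Rightarrow> 'a) \<Rightarrow> 'b measure \<Rightarrow> ('w \<Rightarrow> 'b) \<Rightarrow> bool" where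
  "indep_rvs M A X B Y \<longleftrightarrow>
     X \<in> M \<rightarrow>\<^sub>M A \<and> Y \<in> M \<rightarrow>\<^sub>M B \<and>
     prob_space.indep_set M
       {X -` S \<inter> space M | S. S \<in> sets A} {Y -` S \<inter> space M | S. S \<in> sets B}"


section \<open>Randomization tests and consistency\<close>

definition order_statistic :: "real list \<Rightarrow> nat \<Rightarrow> ereal" where
  "order_statistic xs k = (if k = 0 then - \<infinity> else ereal (sort xs ! (k - 1)))"

text \<open>\<open>g 1, \<dots>, g K\<close> are the random group elements, acting on data by \<open>act\<close>.\<close>

definition randomization_rejects ::
  "('x \<Rightarrow> real) \<Rightarrow> ('g \<Rightarrow> 'x \<Rightarrow> 'x) \<Rightarrow> real \<Rightarrow> nat \<Rightarrow> 'x \<Rightarrow> (nat \<Rightarrow> 'g) \<Rightarrow> bool" where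
  "randomization_rejects f act \<alpha> K x g \<longleftrightarrow>
     ereal (f x) >
       order_statistic (f x # map (\<lambda>i. f (act (g i) x)) [1..<K + 1])
         (nat \<lceil>(1 - \<alpha>) * (real K + 1)\<rceil>)"

text \<open>\<open>rej m s\<close> is the rejection probability of the \<open>m\<close>-th test when the signal is \<open>s\<close>.\<close>

definition consistent_against :: "(nat \<Rightarrow> 'x \<Rightarrow> real) \<Rightarrow> (nat \<Rightarrow> 'x set) \<Rightarrow> bool" where
  "consistent_against rej \<Theta> \<longleftrightarrow>
     (\<forall>s. (\<forall>m\<ge>1. s m \<in> \<Theta> m) \<longrightarrow> (\<lambda>m. rej m (s m)) \<longlonglongrightarrow> 1)"

end

theory Submission
  imports Defs
begin

text \<open>
  A random matrix \<open>Y\<close> of size \<open>n \<times> p\<close> whose law is invariant under rotating the columns separately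
  satisfies \<open>P (\<parallel>Y\<parallel>\<^sub>2\<^sub>,\<^sub>\<infinity> \<le> b \<and> \<parallel>Y\<parallel>\<^sub>o\<^sub>p > (2 + \<gamma>) b (\<surd>n + \<surd>p) / \<surd>n) \<le> exp (- 2 \<gamma> \<surd>(n p))\<close>.
  To see this, rotate \<open>w\<close> to a constant vector and average over sign changes of the entries: this gives
  \<open>E exp (w\<^sup>T Y v) \<le> exp (b\<^sup>2 |w|\<^sup>2 |v|\<^sup>2 / (2 n))\<close> on the event \<open>\<parallel>Y\<parallel>\<^sub>2\<^sub>,\<^sub>\<infinity> \<le> b\<close>.
  Instead of a union bound over nets, average these bounds over random \<open>w\<close> and \<open>v\<close> whose entries are
  scaled sums of fair signs. Tilting the signs so that \<open>w\<close> and \<open>v\<close> have the top singular vectors as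
  means costs relative entropy at most \<open>\<surd>(n p)\<close> each, and Jensen's inequality bounds the average
  from below by an exponential in \<open>\<parallel>Y\<parallel>\<^sub>o\<^sub>p\<close>.

  Both \<open>N\<close> and the rotated data \<open>G\<^sub>k (s + N)\<close> are invariant in this sense, so with probability tending
  to one all \<open>\<parallel>G\<^sub>k (s + N)\<parallel>\<^sub>o\<^sub>p\<close> lie below \<open>\<parallel>s\<parallel>\<^sub>o\<^sub>p - \<parallel>N\<parallel>\<^sub>o\<^sub>p \<le> \<parallel>s + N\<parallel>\<^sub>o\<^sub>p\<close>, and the test rejects.
\<close>

section \<open>The operator norm as a maximum\<close>

text \<open>The product of a matrix with a vector represented as a function on all of
  \<open>nat\<close>, so that the product topology on functions and plain finite sums apply. Values
  of \<open>v\<close> from \<open>dim_col A\<close> on are ignored.\<close>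

definition mvec :: "real mat \<Rightarrow> (nat \<Rightarrow> real) \<Rightarrow> nat \<Rightarrow> real" where
  "mvec A v i = (\<Sum>j<dim_col A. A $$ (i, j) * v j)"

text \<open>Pinning the coordinates from \<open>p\<close> on to 0 makes the sphere a closed subset
  of a product of compact sets, which is compact by Tychonoff.\<close>

lemma compact_unit_sphere:
  "compact {v :: nat \<Rightarrow> real. (\<forall>i\<ge>p. v i = 0) \<and> (\<Sum>i<p. (v i)\<^sup>2) = 1}"
proof -
  let ?S = "\<lambda>i::nat. if i < p then {-1..1::real} else {0}"
  have "compactin (product_topology (\<lambda>_. euclidean) UNIV) (PiE UNIV ?S)"
    by (subst compactin_PiE) (auto simp: compactin_euclidean_iff)
  then have "compact (PiE UNIV ?S)"
    by (simp add: euclidean_product_topology compactin_euclidean_iff)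
  moreover have "closed {v :: nat \<Rightarrow> real. (\<Sum>i<p. (v i)\<^sup>2) = 1}"
    by (intro closed_Collect_eq continuous_intros) auto
  ultimately have "compact (PiE UNIV ?S \<inter> {v :: nat \<Rightarrow> real. (\<Sum>i<p. (v i)\<^sup>2) = 1})"
    by (rule compact_Int_closed)
  moreover have "PiE UNIV ?S \<inter> {v :: nat \<Rightarrow> real. (\<Sum>i<p. (v i)\<^sup>2) = 1}
      = {v :: nat \<Rightarrow> real. (\<forall>i\<ge>p. v i = 0) \<and> (\<Sum>i<p. (v i)\<^sup>2) = 1}"
  proof -
    have "v i \<in> {-1..1}" if "(\<Sum>i<p. (v i)\<^sup>2) = 1" "i < p" for v :: "nat \<Rightarrow> real" and i
    proof -
      have "(v i)\<^sup>2 \<le> (\<Sum>i<p. (v i)\<^sup>2)"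
        using that(2) by (intro member_le_sum) auto
      then show ?thesis
        using that(1) abs_square_le_1[of "v i"] by auto
    qed
    moreover have "v \<in> PiE UNIV ?S \<longleftrightarrow> (\<forall>i<p. v i \<in> {-1..1}) \<and> (\<forall>i\<ge>p. v i = 0)" for v
      by (simp add: PiE_iff) (metis leD leI)
    ultimately show ?thesis by blast
  qed
  ultimately show ?thesis by simp
qed

text \<open>The continuous function |A v|^2 attains its maximum on the compact unit sphere;
  homogeneity of degree two extends the bound to all \<open>w\<close>.\<close>

lemma mvec_sum_sq_attains:
  assumes A: "A \<in> carrier_mat n p" and p: "0 < p"
  obtains v where "(\<Sum>j<p. (v j)\<^sup>2) = 1"
    "\<And>w. (\<Sum>i<n. (mvec A w i)\<^sup>2) \<le> (\<Sum>i<n. (mvec A v i)\<^sup>2) * (\<Sum>j<p. (w j)\<^sup>2)"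
proof -
  let ?Q = "\<lambda>v. \<Sum>i<n. (mvec A v i)\<^sup>2"
  let ?S = "{v :: nat \<Rightarrow> real. (\<forall>i\<ge>p. v i = 0) \<and> (\<Sum>i<p. (v i)\<^sup>2) = 1}"
  have "(if i = 0 then 1 else 0 :: real)\<^sup>2 = (if i = 0 then 1 else 0)" for i :: nat
    by simp
  then have "(\<lambda>i. if i = 0 then 1 else 0) \<in> ?S"
    using p by (simp add: sum.delta)
  then have ne: "?S \<noteq> {}"
    by (intro notI) (simp only: empty_iff)
  have c1: "continuous_on UNIV (\<lambda>v :: nat \<Rightarrow> real. c * v j)" for c j
    by (rule continuous_on_mult_left[OF continuous_on_product_coordinates])
  have c2: "continuous_on UNIV (\<lambda>v. mvec A v i)" for i
    unfolding mvec_def by (rule continuous_on_sum, rule c1)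
  have "continuous_on UNIV ?Q"
    by (rule continuous_on_sum[OF continuous_on_power[OF c2]])
  then have cont: "continuous_on ?S ?Q"
    by (rule continuous_on_subset) simp
  obtain v where v: "v \<in> ?S" "\<And>w. w \<in> ?S \<Longrightarrow> ?Q w \<le> ?Q v"
  proof -
    obtain v where "v \<in> ?S" "\<forall>w\<in>?S. ?Q w \<le> ?Q v"
      using continuous_attains_sup[OF compact_unit_sphere ne cont] by (rule bexE)
    then show thesis by (intro that[of v]) simp_all
  qed
  have "?Q w \<le> ?Q v * (\<Sum>j<p. (w j)\<^sup>2)" for w
  proof (cases "(\<Sum>j<p. (w j)\<^sup>2) = 0")
    case True
    then have "w j = 0" if "j < p" for j
      using that by (subst (asm) sum_nonneg_eq_0_iff) auto
    then have "mvec A w i = 0" for i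
      using A by (auto simp: mvec_def intro!: sum.neutral)
    with True show ?thesis by simp
  next
    case False
    define r where "r = sqrt (\<Sum>j<p. (w j)\<^sup>2)"
    have r2: "r\<^sup>2 = (\<Sum>j<p. (w j)\<^sup>2)"
      unfolding r_def by (intro real_sqrt_pow2 sum_nonneg) simp
    have r: "r \<noteq> 0"
      using False by (simp add: r_def)
    \<comment> \<open>Besides scaling, the coordinates from \<open>p\<close> on are cut off, since
      the compact sphere requires them to vanish.\<close>
    define w' where "w' j = (if j < p then w j / r else 0)" for j
    have "(\<Sum>j<p. (w' j)\<^sup>2) = (\<Sum>j<p. (w j)\<^sup>2) / r\<^sup>2"
      by (simp add: w'_def power_divide sum_divide_distrib)
    also have "\<dots> = 1"
      unfolding r2[symmetric] using r by simp
    finally have "w' \<in> ?S"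
      by (simp add: w'_def)
    from v(2)[OF this] have le: "?Q w' \<le> ?Q v" .
    have "mvec A w' i = mvec A w i / r" for i
      unfolding mvec_def sum_divide_distrib using A by (intro sum.cong) (simp_all add: w'_def)
    then have "?Q w' = ?Q w / r\<^sup>2"
      by (simp add: power_divide sum_divide_distrib)
    with le have "?Q w / r\<^sup>2 \<le> ?Q v" by simp
    then have "?Q w \<le> ?Q v * r\<^sup>2"
      using r by (subst (asm) pos_divide_le_eq) simp_all
    then show ?thesis by (simp only: r2)
  qed
  moreover have "(\<Sum>j<p. (v j)\<^sup>2) = 1"
    using v(1) by simp
  ultimately show ?thesis by (rule that[rotated])
qed

lemma mvec_adjoint:
  assumes A: "A \<in> carrier_mat n p"
  shows "(\<Sum>i<n. u i * mvec A w i) = (\<Sum>k<p. w k * mvec (transpose_mat A) u k)"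
proof -
  have "(\<Sum>i<n. u i * mvec A w i) = (\<Sum>i<n. \<Sum>k<p. w k * (A $$ (i, k) * u i))"
    using A by (auto simp: mvec_def sum_distrib_left mult_ac)
  also have "\<dots> = (\<Sum>k<p. \<Sum>i<n. w k * (A $$ (i, k) * u i))"
    by (rule sum.swap)
  also have "\<dots> = (\<Sum>k<p. w k * mvec (transpose_mat A) u k)"
    using A by (auto simp: mvec_def sum_distrib_left intro!: sum.cong)
  finally show ?thesis .
qed

lemma mvec_lincomb:
  "mvec A (\<lambda>j. a * v j + b * w j) i = a * mvec A v i + b * mvec A w i"
  by (simp add: mvec_def sum.distrib sum_distrib_left distrib_left mult_ac)

text \<open>The form \<open>\<mu> |v|\<^sup>2 - |A v|\<^sup>2\<close> is nonnegative, so it is stationary at a zero.\<close>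

lemma mvec_maximizer_eigen:
  assumes A: "A \<in> carrier_mat n p" and v: "(\<Sum>j<p. (v j)\<^sup>2) = 1"
    and max: "\<And>w. (\<Sum>i<n. (mvec A w i)\<^sup>2) \<le> \<mu> * (\<Sum>j<p. (w j)\<^sup>2)"
    and \<mu>: "\<mu> = (\<Sum>i<n. (mvec A v i)\<^sup>2)" and k: "k < p"
  shows "mvec (transpose_mat A) (mvec A v) k = \<mu> * v k"
proof -
  \<comment> \<open>\<open>z\<close> is half the gradient of the form at \<open>v\<close>; the goal
    is that it vanishes on the first \<open>p\<close> coordinates.\<close>
  define z where "z k = \<mu> * v k - mvec (transpose_mat A) (mvec A v) k" for k
  define S where "S = (\<Sum>k<p. (z k)\<^sup>2)"
  define C where "C = \<mu> * S - (\<Sum>i<n. (mvec A z i)\<^sup>2)"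
  have S: "S = \<mu> * (\<Sum>k<p. v k * z k) - (\<Sum>i<n. mvec A v i * mvec A z i)"
  proof -
    have "S = (\<Sum>k<p. \<mu> * (v k * z k) - z k * mvec (transpose_mat A) (mvec A v) k)"
      unfolding S_def by (intro sum.cong) (auto simp: z_def power2_eq_square algebra_simps)
    then show ?thesis
      by (simp add: sum_subtractf sum_distrib_left mvec_adjoint[OF A])
  qed
  \<comment> \<open>The form is nonnegative at v - \<tau> z. Its value at \<open>v\<close> is 0, its
    linear term is -2 \<tau> S and its quadratic term is \<tau>^2 C.\<close>
  have ineq: "2 * \<tau> * S \<le> \<tau>\<^sup>2 * C" for \<tau>
  proof -
    have "mvec A (\<lambda>j. v j - \<tau> * z j) i = mvec A v i - \<tau> * mvec A z i" for i
      using mvec_lincomb[of A 1 v "-\<tau>" z i] by simp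
    then have "(\<Sum>i<n. (mvec A v i - \<tau> * mvec A z i)\<^sup>2) \<le> \<mu> * (\<Sum>j<p. (v j - \<tau> * z j)\<^sup>2)"
      using max[of "\<lambda>j. v j - \<tau> * z j"] by simp
    moreover have "(\<Sum>i<n. (mvec A v i - \<tau> * mvec A z i)\<^sup>2)
        = \<mu> - 2 * \<tau> * (\<Sum>i<n. mvec A v i * mvec A z i) + \<tau>\<^sup>2 * (\<Sum>i<n. (mvec A z i)\<^sup>2)"
      by (simp add: \<mu> power2_diff sum.distrib sum_subtractf sum_distrib_left power_mult_distrib mult_ac)
    moreover have "(\<Sum>j<p. (v j - \<tau> * z j)\<^sup>2)
        = 1 - 2 * \<tau> * (\<Sum>k<p. v k * z k) + \<tau>\<^sup>2 * S"
      by (simp add: v[symmetric] S_def power2_diff sum.distrib sum_subtractf sum_distrib_left power_mult_distrib mult_ac)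
    ultimately have "\<mu> - 2 * \<tau> * (\<Sum>i<n. mvec A v i * mvec A z i) + \<tau>\<^sup>2 * (\<Sum>i<n. (mvec A z i)\<^sup>2)
       \<le> \<mu> * (1 - 2 * \<tau> * (\<Sum>k<p. v k * z k) + \<tau>\<^sup>2 * S)"
      by simp
    then show ?thesis
      by (subst S) (simp add: C_def algebra_simps)
  qed
  have "S = 0"
  proof (rule ccontr)
    assume "S \<noteq> 0"
    \<comment> \<open>The step \<tau> = S / (|C| + 1) is so short that the linear term wins: the
      inequality would give 2 (|C| + 1) \<le> C.\<close>
    let ?c = "\<bar>C\<bar> + 1"
    from ineq[of "S / ?c"] have "2 * (S / ?c) * S \<le> (S / ?c)\<^sup>2 * C" .
    moreover have "2 * (S / ?c) * S = (S / ?c)\<^sup>2 * (2 * ?c)"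
    proof -
      have "S = S / ?c * ?c" by simp
      then show ?thesis by (metis power2_eq_square mult.assoc mult.commute)
    qed
    ultimately have "(S / ?c)\<^sup>2 * (2 * ?c) \<le> (S / ?c)\<^sup>2 * C" by simp
    moreover have "0 < (S / ?c)\<^sup>2" using \<open>S \<noteq> 0\<close> by simp
    ultimately have "2 * ?c \<le> C" by (rule mult_left_le_imp_le)
    with abs_ge_self[of C] abs_ge_zero[of C] show False by (simp add: algebra_simps)
  qed
  then have "z k = 0"
    unfolding S_def using k by (subst (asm) sum_nonneg_eq_0_iff) auto
  then show ?thesis by (simp add: z_def)
qed

lemma vec_index_gram:
  assumes A: "A \<in> carrier_mat n p" and x: "x \<in> carrier_vec p" and k: "k < p"
  shows "vec_index (transpose_mat A * A *\<^sub>v x) k = mvec (transpose_mat A) (mvec A (vec_index x)) k"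
proof -
  have "transpose_mat A * A *\<^sub>v x = transpose_mat A *\<^sub>v (A *\<^sub>v x)"
    using A x by (intro assoc_mult_mat_vec) auto
  then show ?thesis
    using A x k by (auto simp: mvec_def scalar_prod_def lessThan_atLeast0 intro!: sum.cong)
qed

text \<open>The maximum \<mu> of |A v|^2 over the unit sphere is an eigenvalue of A^T A by
  stationarity, and no eigenvalue exceeds it, as seen by evaluating the form at an eigenvector.
  Hence \<open>op_norm A\<close> is the square root of \<mu>, and all later facts use only this
  variational description.\<close>

lemma op_norm_attained:
  assumes A: "A \<in> carrier_mat n p" and p: "0 < p"
  obtains v where "(\<Sum>j<p. (v j)\<^sup>2) = 1" "(\<Sum>i<n. (mvec A v i)\<^sup>2) = (op_norm A)\<^sup>2" "0 \<le> op_norm A"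
    "\<And>w. (\<Sum>i<n. (mvec A w i)\<^sup>2) \<le> (op_norm A)\<^sup>2 * (\<Sum>j<p. (w j)\<^sup>2)"
proof -
  obtain v where v: "(\<Sum>j<p. (v j)\<^sup>2) = 1"
    "\<And>w. (\<Sum>i<n. (mvec A w i)\<^sup>2) \<le> (\<Sum>i<n. (mvec A v i)\<^sup>2) * (\<Sum>j<p. (w j)\<^sup>2)"
    using mvec_sum_sq_attains[OF A p] by blast
  define \<mu> where "\<mu> = (\<Sum>i<n. (mvec A v i)\<^sup>2)"
  have \<mu>: "0 \<le> \<mu>" by (simp add: \<mu>_def sum_nonneg)
  let ?B = "transpose_mat A * A"
  have B: "?B \<in> carrier_mat p p" using A by auto
  have "eigenvector ?B (vec p v) \<mu>"
  proof -
    have "vec p v \<noteq> 0\<^sub>v p"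
    proof
      assume "vec p v = 0\<^sub>v p"
      then have "v j = 0" if "j < p" for j
        using that by (metis index_vec index_zero_vec(1))
      with v(1) show False by simp
    qed
    moreover have "?B *\<^sub>v vec p v = \<mu> \<cdot>\<^sub>v vec p v"
    proof (intro eq_vecI)
      fix k assume "k < dim_vec (\<mu> \<cdot>\<^sub>v vec p v)"
      then have k: "k < p" by simp
      have "mvec A (vec_index (vec p v)) = mvec A v"
        using A by (auto simp: mvec_def fun_eq_iff intro!: sum.cong)
      then show "vec_index (?B *\<^sub>v vec p v) k = vec_index (\<mu> \<cdot>\<^sub>v vec p v) k"
        using k vec_index_gram[OF A, of "vec p v" k] mvec_maximizer_eigen[OF A v(1) v(2)[folded \<mu>_def] \<mu>_def k]
        by simp
    qed (use A in auto)
    ultimately show ?thesis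
      using A by (simp add: eigenvector_def)
  qed
  then have mem: "sqrt \<mu> \<in> singular_values A"
    by (auto simp: singular_values_def eigenvalue_def)
  \<comment> \<open>\<open>Max\<close> is meaningful only on a finite set: the eigenvalues are the
    roots of a nonzero polynomial.\<close>
  have fin: "finite (singular_values A)"
  proof -
    have "char_poly ?B \<noteq> 0"
      using degree_monic_char_poly[OF B] by auto
    then have "finite {l. eigenvalue ?B l}"
      using eigenvalue_root_char_poly[OF B] poly_roots_finite[of "char_poly ?B"] by simp
    then show ?thesis
      by (simp add: singular_values_def setcompr_eq_image)
  qed
  have "s \<le> sqrt \<mu>" if "s \<in> singular_values A" for s
  proof -
    from that obtain l x where l: "s = sqrt l" "eigenvector ?B x l"
      by (auto simp: singular_values_def eigenvalue_def)
    then have x: "x \<in> carrier_vec p" "x \<noteq> 0\<^sub>v p" "?B *\<^sub>v x = l \<cdot>\<^sub>v x"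
      using A by (auto simp: eigenvector_def)
    let ?x = "vec_index x"
    have "mvec (transpose_mat A) (mvec A ?x) k = l * ?x k" if "k < p" for k
      using vec_index_gram[OF A x(1) that] x that by simp
    then have "(\<Sum>i<n. mvec A ?x i * mvec A ?x i) = (\<Sum>k<p. ?x k * (l * ?x k))"
      unfolding mvec_adjoint[OF A] by simp
    then have "l * (\<Sum>k<p. (?x k)\<^sup>2) = (\<Sum>i<n. (mvec A ?x i)\<^sup>2)"
      by (simp add: power2_eq_square sum_distrib_left mult_ac)
    also have "\<dots> \<le> \<mu> * (\<Sum>k<p. (?x k)\<^sup>2)"
      using v(2) by (simp add: \<mu>_def)
    finally have le: "l * (\<Sum>k<p. (?x k)\<^sup>2) \<le> \<mu> * (\<Sum>k<p. (?x k)\<^sup>2)" .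
    obtain k where k: "k < p" "?x k \<noteq> 0"
      using x(1,2) by (metis carrier_vecD eq_vecI index_zero_vec)
    then have "0 < (\<Sum>k<p. (?x k)\<^sup>2)"
      by (intro sum_pos2[of _ k]) auto
    with le have "l \<le> \<mu>" by (simp add: mult_le_cancel_right)
    then show ?thesis using l by simp
  qed
  with mem fin have "op_norm A = sqrt \<mu>"
    by (auto simp: op_norm_def intro!: Max_eqI)
  then show ?thesis
    using that[of v] v \<mu> by (simp add: \<mu>_def)
qed

section \<open>Norm inequalities and top singular vectors\<close>

lemma op_norm_nonneg: "A \<in> carrier_mat n p \<Longrightarrow> 0 < p \<Longrightarrow> 0 \<le> op_norm A"
  by (rule op_norm_attained)

lemma L2_set_mvec_le:
  assumes "A \<in> carrier_mat n p" "0 < p"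
  shows "L2_set (mvec A w) {..<n} \<le> op_norm A * L2_set w {..<p}"
proof -
  obtain v where v: "0 \<le> op_norm A"
    "(\<Sum>i<n. (mvec A w i)\<^sup>2) \<le> (op_norm A)\<^sup>2 * (\<Sum>j<p. (w j)\<^sup>2)"
    using op_norm_attained[OF assms] by blast
  then have "sqrt (\<Sum>i<n. (mvec A w i)\<^sup>2) \<le> sqrt ((op_norm A)\<^sup>2 * (\<Sum>j<p. (w j)\<^sup>2))"
    by simp
  with v(1) show ?thesis
    by (simp add: L2_set_def real_sqrt_mult)
qed

lemma op_norm_attained_L2:
  assumes "A \<in> carrier_mat n p" "0 < p"
  obtains v where "L2_set v {..<p} = 1" "L2_set (mvec A v) {..<n} = op_norm A"
proof -
  obtain v where v: "(\<Sum>j<p. (v j)\<^sup>2) = 1" "(\<Sum>i<n. (mvec A v i)\<^sup>2) = (op_norm A)\<^sup>2" "0 \<le> op_norm A"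
    using op_norm_attained[OF assms] by blast
  then show ?thesis
    using that[of v] by (simp add: L2_set_def)
qed

text \<open>The maximiser \<open>v\<close> of \<open>A\<close> serves as a test vector: |A v| \<le>
  |(A + B) v| + |B v|. With the signal as \<open>A\<close> and the noise as \<open>B\<close>, this
  bounds the test statistic from below.\<close>

lemma op_norm_diff_le:
  assumes A: "A \<in> carrier_mat n p" and B: "B \<in> carrier_mat n p" and p: "0 < p"
  shows "op_norm A \<le> op_norm (A + B) + op_norm B"
proof -
  obtain v where v: "L2_set v {..<p} = 1" "L2_set (mvec A v) {..<n} = op_norm A"
    using op_norm_attained_L2[OF A p] by blast
  have "mvec (A + B) v i = mvec A v i + mvec B v i" if "i < n" for i
    using A B that by (auto simp: mvec_def sum.distrib[symmetric] distrib_right)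
  then have "L2_set (mvec A v) {..<n} = L2_set (\<lambda>i. mvec (A + B) v i + - mvec B v i) {..<n}"
    by (intro L2_set_cong) auto
  also have "\<dots> \<le> L2_set (mvec (A + B) v) {..<n} + L2_set (\<lambda>i. - mvec B v i) {..<n}"
    by (rule L2_set_triangle_ineq)
  also have "L2_set (\<lambda>i. - mvec B v i) {..<n} = L2_set (mvec B v) {..<n}"
    by (simp add: L2_set_def)
  finally show ?thesis
    using v L2_set_mvec_le[of "A + B" n p v] L2_set_mvec_le[OF B p, of v] A B p by auto
qed

text \<open>Settles the degenerate case of the tail bound in which the columns are bounded by
  0.\<close>

lemma op_norm_zero_columns:
  assumes A: "A \<in> carrier_mat n p" and p: "0 < p" and 0: "\<And>i j. i < n \<Longrightarrow> j < p \<Longrightarrow> A $$ (i, j) = 0"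
  shows "op_norm A = 0"
proof -
  obtain v where v: "L2_set (mvec A v) {..<n} = op_norm A"
    using op_norm_attained_L2[OF A p] by blast
  have "mvec A v i = 0" if "i < n" for i
    using A 0 that by (auto simp: mvec_def intro!: sum.neutral)
  then have "L2_set (mvec A v) {..<n} = 0"
    by (simp add: L2_set_def)
  with v show ?thesis by simp
qed

text \<open>\<open>u\<close> and \<open>v\<close> are top singular vectors: \<open>v\<close>
  maximises |A v|, and \<open>u\<close> is A v divided by its norm, whence the positivity
  assumption.\<close>

lemma op_norm_dual:
  assumes A: "A \<in> carrier_mat n p" and p: "0 < p" and pos: "0 < op_norm A"
  obtains u v where "(\<Sum>i<n. (u i)\<^sup>2) = 1" "(\<Sum>j<p. (v j)\<^sup>2) = 1" "(\<Sum>i<n. u i * mvec A v i) = op_norm A"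
proof -
  obtain v where v: "(\<Sum>j<p. (v j)\<^sup>2) = 1" "(\<Sum>i<n. (mvec A v i)\<^sup>2) = (op_norm A)\<^sup>2"
    using op_norm_attained[OF A p] by blast
  define u where "u i = mvec A v i / op_norm A" for i
  have "(\<Sum>i<n. (u i)\<^sup>2) = 1"
    using pos v(2) by (simp add: u_def power_divide flip: sum_divide_distrib)
  moreover have "(\<Sum>i<n. u i * mvec A v i) = op_norm A"
  proof -
    have "(\<Sum>i<n. u i * mvec A v i) = (\<Sum>i<n. (mvec A v i)\<^sup>2) / op_norm A"
      by (simp add: u_def sum_divide_distrib power2_eq_square)
    also have "\<dots> = op_norm A" using v(2) pos by (simp add: power2_eq_square)
    finally show ?thesis .
  qed
  ultimately show ?thesis using that v(1) by blast
qed

section \<open>Averages over tilted signs\<close>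

definition signs :: "'i set \<Rightarrow> ('i \<Rightarrow> real) set" where
  "signs S = PiE S (\<lambda>_. {-1, 1})"

text \<open>The expectation of \<phi> under independent signs with means \<open>m s\<close>: the
  sign at \<open>s\<close> takes the value e with probability (1 + m s * e) / 2. For |m s| \<le> 1
  the weights form a probability distribution; \<open>m = 0\<close> gives fair signs.\<close>

definition sign_mean :: "'i set \<Rightarrow> ('i \<Rightarrow> real) \<Rightarrow> (('i \<Rightarrow> real) \<Rightarrow> real) \<Rightarrow> real" where
  "sign_mean S m \<phi> = (\<Sum>\<epsilon>\<in>signs S. (\<Prod>s\<in>S. (1 + m s * \<epsilon> s) / 2) * \<phi> \<epsilon>)"

lemma signs_cases: "\<epsilon> \<in> signs S \<Longrightarrow> s \<in> S \<Longrightarrow> \<epsilon> s = -1 \<or> \<epsilon> s = 1"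
  by (auto simp: signs_def PiE_iff)

text \<open>Independence of the signs: the weights factor over \<open>S\<close>, and a sum of
  products over a product set is a product of sums. The moments and exponential moments below come
  from suitable choices of the factors.\<close>

lemma sign_mean_prod:
  assumes "finite S"
  shows "sign_mean S m (\<lambda>\<epsilon>. \<Prod>s\<in>S. f s (\<epsilon> s))
    = (\<Prod>s\<in>S. (1 - m s) / 2 * f s (-1) + (1 + m s) / 2 * f s 1)"
proof -
  have "sign_mean S m (\<lambda>\<epsilon>. \<Prod>s\<in>S. f s (\<epsilon> s))
      = (\<Sum>\<epsilon>\<in>PiE S (\<lambda>_. {-1, 1}). \<Prod>s\<in>S. (1 + m s * \<epsilon> s) / 2 * f s (\<epsilon> s))"
    by (simp only: sign_mean_def signs_def prod.distrib)
  also have "\<dots> = (\<Prod>s\<in>S. \<Sum>e\<in>{-1, 1}. (1 + m s * e) / 2 * f s e)"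
    using assms by (intro prod_sum_PiE[symmetric]) auto
  finally show ?thesis by simp
qed

lemma sign_mean_const [simp]: "finite S \<Longrightarrow> sign_mean S m (\<lambda>_. c) = c"
proof -
  assume "finite S"
  then have "sign_mean S m (\<lambda>\<epsilon>. \<Prod>s\<in>S. 1) = 1"
    by (subst sign_mean_prod) (simp_all add: field_simps)
  then show ?thesis
    by (simp add: sign_mean_def flip: sum_distrib_right)
qed

lemma sign_mean_coord:
  assumes "finite S" "a \<in> S"
  shows "sign_mean S m (\<lambda>\<epsilon>. \<epsilon> a) = m a"
proof -
  have "sign_mean S m (\<lambda>\<epsilon>. \<epsilon> a) = sign_mean S m (\<lambda>\<epsilon>. \<Prod>s\<in>S. if s = a then \<epsilon> s else 1)"
    using assms by (simp add: prod.delta)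
  also have "\<dots> = (\<Prod>s\<in>S. if s = a then m s else 1)"
    by (subst sign_mean_prod[OF assms(1)], intro prod.cong refl) (simp add: field_simps)
  finally show ?thesis using assms by (simp add: prod.delta)
qed

lemma sign_mean_coord_mult:
  assumes "finite S" "a \<in> S" "b \<in> S" "a \<noteq> b"
  shows "sign_mean S m (\<lambda>\<epsilon>. \<epsilon> a * \<epsilon> b) = m a * m b"
proof -
  have "sign_mean S m (\<lambda>\<epsilon>. \<epsilon> a * \<epsilon> b)
      = sign_mean S m (\<lambda>\<epsilon>. \<Prod>s\<in>S. (if s = a then \<epsilon> s else 1) * (if s = b then \<epsilon> s else 1))"
    using assms by (simp add: prod.delta prod.distrib)
  also have "\<dots> = (\<Prod>s\<in>S. (if s = a then m s else 1) * (if s = b then m s else 1))"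
    using assms(4)
    by (subst sign_mean_prod[OF assms(1), where f = "\<lambda>s e. (if s = a then e else 1) * (if s = b then e else 1)"],
        intro prod.cong refl) (auto simp: field_simps)
  finally show ?thesis using assms by (simp add: prod.delta prod.distrib)
qed

lemma sign_mean_cong:
  "(\<And>\<epsilon>. \<epsilon> \<in> signs S \<Longrightarrow> \<phi> \<epsilon> = \<psi> \<epsilon>) \<Longrightarrow> sign_mean S m \<phi> = sign_mean S m \<psi>"
  by (simp add: sign_mean_def)

lemma sign_mean_add: "sign_mean S m (\<lambda>\<epsilon>. \<phi> \<epsilon> + \<psi> \<epsilon>) = sign_mean S m \<phi> + sign_mean S m \<psi>"
  by (simp add: sign_mean_def distrib_left sum.distrib)

lemma sign_mean_diff: "sign_mean S m (\<lambda>\<epsilon>. \<phi> \<epsilon> - \<psi> \<epsilon>) = sign_mean S m \<phi> - sign_mean S m \<psi>"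
  by (simp add: sign_mean_def right_diff_distrib sum_subtractf)

lemma sign_mean_cmult: "sign_mean S m (\<lambda>\<epsilon>. c * \<phi> \<epsilon>) = c * sign_mean S m \<phi>"
  by (simp add: sign_mean_def sum_distrib_left mult_ac)

lemma sign_mean_multc: "sign_mean S m (\<lambda>\<epsilon>. \<phi> \<epsilon> * c) = sign_mean S m \<phi> * c"
  using sign_mean_cmult[of S m c \<phi>] by (simp add: mult.commute)

lemma sign_mean_sum:
  "sign_mean S m (\<lambda>\<epsilon>. \<Sum>i\<in>I. \<phi> i \<epsilon>) = (\<Sum>i\<in>I. sign_mean S m (\<phi> i))"
  unfolding sign_mean_def sum_distrib_left by (rule sum.swap)

section \<open>Jensen's inequality, change of weights and second moments\<close>

context
  fixes S :: "'i set" and m :: "'i \<Rightarrow> real"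
  assumes fin: "finite S" and m: "\<And>s. s \<in> S \<Longrightarrow> \<bar>m s\<bar> \<le> 1"
begin

lemma sign_weight_factor_nonneg:
  assumes "\<epsilon> \<in> signs S" "s \<in> S"
  shows "0 \<le> (1 + m s * \<epsilon> s) / 2"
proof -
  have "- 1 \<le> m s" "m s \<le> 1" using m[OF assms(2)] by (simp_all add: abs_le_iff)
  then show ?thesis using signs_cases[OF assms] by auto
qed

lemma sign_mean_mono:
  assumes "\<And>\<epsilon>. \<epsilon> \<in> signs S \<Longrightarrow> \<phi> \<epsilon> \<le> \<psi> \<epsilon>"
  shows "sign_mean S m \<phi> \<le> sign_mean S m \<psi>"
  unfolding sign_mean_def
  by (intro sum_mono mult_left_mono assms prod_nonneg sign_weight_factor_nonneg)

text \<open>Jensen's inequality: the tangent of exp at the mean \<open>c\<close> lies below exp, and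
  its average is exp c.\<close>

lemma exp_sign_mean_le: "exp (sign_mean S m X) \<le> sign_mean S m (\<lambda>\<epsilon>. exp (X \<epsilon>))"
proof -
  define c where "c = sign_mean S m X"
  have "exp c * (1 + (X \<epsilon> - c)) \<le> exp (X \<epsilon>)" for \<epsilon>
  proof -
    have "exp c * (1 + (X \<epsilon> - c)) \<le> exp c * exp (X \<epsilon> - c)"
      by (intro mult_left_mono exp_ge_add_one_self) simp
    then show ?thesis by (simp flip: exp_add)
  qed
  then have "sign_mean S m (\<lambda>\<epsilon>. exp c * (1 + (X \<epsilon> - c))) \<le> sign_mean S m (\<lambda>\<epsilon>. exp (X \<epsilon>))"
    by (intro sign_mean_mono)
  then show ?thesis
    using fin by (simp add: sign_mean_cmult sign_mean_add sign_mean_diff flip: c_def)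
qed

text \<open>The density of the tilted weights with respect to the uniform ones is
  \<open>\<Prod>(1 + m s * \<epsilon> s) \<le> exp (\<Sum>m s * \<epsilon> s)\<close>, so the relative entropy is at most \<open>\<Sum>(m s)\<^sup>2\<close>.\<close>

lemma sign_mean_tilt:
  assumes "\<And>\<epsilon>. \<epsilon> \<in> signs S \<Longrightarrow> 0 \<le> \<phi> \<epsilon>"
  shows "sign_mean S m (\<lambda>\<epsilon>. \<phi> \<epsilon> * exp (- (\<Sum>s\<in>S. m s * \<epsilon> s))) \<le> sign_mean S (\<lambda>_. 0) \<phi>"
  unfolding sign_mean_def
proof (rule sum_mono)
  fix \<epsilon> assume \<epsilon>: "\<epsilon> \<in> signs S"
  have "(\<Prod>s\<in>S. (1 + m s * \<epsilon> s) / 2) \<le> (\<Prod>s\<in>S. exp (m s * \<epsilon> s) / 2)"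
    by (intro prod_mono conjI sign_weight_factor_nonneg \<epsilon> divide_right_mono exp_ge_add_one_self) simp_all
  also have "\<dots> = exp (\<Sum>s\<in>S. m s * \<epsilon> s) * (\<Prod>s\<in>S. 1 / 2)"
    by (simp only: exp_sum[OF fin] prod.distrib[symmetric]) simp
  finally have "(\<Prod>s\<in>S. (1 + m s * \<epsilon> s) / 2) * exp (- (\<Sum>s\<in>S. m s * \<epsilon> s)) \<le> (\<Prod>s\<in>S. 1 / 2)"
    unfolding exp_minus by (subst divide_inverse[symmetric], subst pos_divide_le_eq) (simp_all add: mult.commute)
  from mult_right_mono[OF this assms[OF \<epsilon>]]
  show "(\<Prod>s\<in>S. (1 + m s * \<epsilon> s) / 2) * (\<phi> \<epsilon> * exp (- (\<Sum>s\<in>S. m s * \<epsilon> s)))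
      \<le> (\<Prod>s\<in>S. (1 + 0 * \<epsilon> s) / 2) * \<phi> \<epsilon>"
    by (simp add: mult_ac)
qed

text \<open>A sum of independent signs has variance at most the number of signs: squares of signs
  are 1, and distinct signs are uncorrelated.\<close>

lemma sign_mean_sum_square_le:
  assumes T: "T \<subseteq> S"
  shows "sign_mean S m (\<lambda>\<epsilon>. (\<Sum>s\<in>T. \<epsilon> s)\<^sup>2) \<le> (\<Sum>s\<in>T. m s)\<^sup>2 + card T"
proof -
  have finT: "finite T" using T fin by (rule finite_subset)
  have "sign_mean S m (\<lambda>\<epsilon>. \<epsilon> a * \<epsilon> b) \<le> m a * m b + (if a = b then 1 else 0)"
    if "a \<in> T" "b \<in> T" for a b
  proof (cases "a = b")
    case True
    have "sign_mean S m (\<lambda>\<epsilon>. \<epsilon> a * \<epsilon> a) = sign_mean S m (\<lambda>_. 1)"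
      using that(1) T by (intro sign_mean_cong) (auto dest: signs_cases)
    then show ?thesis using True fin by simp
  next
    case False
    then show ?thesis
      using sign_mean_coord_mult[OF fin subsetD[OF T that(1)] subsetD[OF T that(2)], of m] by simp
  qed
  then have "(\<Sum>a\<in>T. \<Sum>b\<in>T. sign_mean S m (\<lambda>\<epsilon>. \<epsilon> a * \<epsilon> b))
      \<le> (\<Sum>a\<in>T. \<Sum>b\<in>T. m a * m b + (if a = b then 1 else 0))"
    by (intro sum_mono)
  also have "\<dots> = (\<Sum>s\<in>T. m s)\<^sup>2 + card T"
    using finT by (simp add: sum.distrib power2_eq_square sum_product)
  also have "(\<Sum>a\<in>T. \<Sum>b\<in>T. sign_mean S m (\<lambda>\<epsilon>. \<epsilon> a * \<epsilon> b)) = sign_mean S m (\<lambda>\<epsilon>. (\<Sum>s\<in>T. \<epsilon> s)\<^sup>2)"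
    by (simp add: power2_eq_square sum_product sign_mean_sum)
  finally show ?thesis .
qed

end

section \<open>Random vectors whose entries are scaled sums of signs\<close>

text \<open>Entry \<open>i\<close> is a sum of the \<open>L\<close> signs in row \<open>i\<close>,
  scaled by \<open>h\<close>. Using many signs decouples two requirements: the range h L has to
  reach the means, which may be as large as 1, while the variance h^2 L under fair signs has to
  equal the prescribed 1 / q.\<close>

definition block_sum :: "real \<Rightarrow> nat \<Rightarrow> (nat \<times> nat \<Rightarrow> real) \<Rightarrow> nat \<Rightarrow> real" where
  "block_sum h L \<epsilon> i = h * (\<Sum>l<L. \<epsilon> (i, l))"

lemma abs_le_one_if_sum_squares_one:
  fixes n :: nat
  assumes "(\<Sum>i<n. (u i)\<^sup>2) = (1::real)" "i < n"
  shows "\<bar>u i\<bar> \<le> 1"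
proof -
  have "(u i)\<^sup>2 \<le> (\<Sum>i<n. (u i)\<^sup>2)"
    using assms(2) by (intro member_le_sum) auto
  then show ?thesis using assms(1) by (simp add: abs_square_le_1)
qed

context
  fixes n L :: nat and h q :: real and u :: "nat \<Rightarrow> real" and m :: "nat \<times> nat \<Rightarrow> real"
  assumes h: "0 < h" and hL: "1 \<le> h * L" and hq: "h\<^sup>2 * L * q = 1"
    and u: "(\<Sum>i<n. (u i)\<^sup>2) = 1"
    and m: "m = (\<lambda>(i, l). u i / (h * L))"
begin

abbreviation (input) "grid \<equiv> {..<n} \<times> {..<L}"

lemma L_pos: "0 < L"
  using hL by (cases L) auto

text \<open>The mean u i / (h L) of each sign in row \<open>i\<close> gives the block sum the mean
  \<open>u i\<close>; it is admissible because |u i| \<le> 1 \<le> h L.\<close>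

lemma tilt_bounded:
  assumes "s \<in> grid"
  shows "\<bar>m s\<bar> \<le> 1"
proof -
  obtain i l where s: "s = (i, l)" "i < n" using assms by auto
  have "\<bar>u i\<bar> \<le> h * L"
    using abs_le_one_if_sum_squares_one[OF u s(2)] hL by simp
  moreover have "0 < h * L" using hL by simp
  ultimately show ?thesis by (simp add: s(1) m abs_divide)
qed

lemma sign_mean_block_sum:
  assumes "i < n"
  shows "sign_mean grid m (\<lambda>\<epsilon>. block_sum h L \<epsilon> i) = u i"
  using assms h L_pos
  by (simp add: block_sum_def sign_mean_cmult sign_mean_sum sign_mean_coord m)

text \<open>Each entry contributes its squared mean, and these add up to 1, plus a variance of at
  most h^2 L = 1 / q.\<close>

lemma sign_mean_block_sum_square:
  "sign_mean grid m (\<lambda>\<epsilon>. \<Sum>i<n. (block_sum h L \<epsilon> i)\<^sup>2) \<le> 1 + n / q"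
proof -
  have "sign_mean grid m (\<lambda>\<epsilon>. (block_sum h L \<epsilon> i)\<^sup>2) \<le> (u i)\<^sup>2 + 1 / q" if i: "i < n" for i
  proof -
    have eq: "(\<Sum>l<L. \<epsilon> (i, l)) = (\<Sum>s\<in>{i} \<times> {..<L}. \<epsilon> s)" for \<epsilon> :: "nat \<times> nat \<Rightarrow> real"
    proof -
      have "(\<Sum>s\<in>{i} \<times> {..<L}. \<epsilon> s) = (\<Sum>a\<in>{i}. \<Sum>l<L. \<epsilon> (a, l))"
        by (subst sum.cartesian_product) simp
      then show ?thesis by simp
    qed
    have "sign_mean grid m (\<lambda>\<epsilon>. (block_sum h L \<epsilon> i)\<^sup>2)
        = h\<^sup>2 * sign_mean grid m (\<lambda>\<epsilon>. (\<Sum>s\<in>{i} \<times> {..<L}. \<epsilon> s)\<^sup>2)"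
      by (simp add: block_sum_def power_mult_distrib sign_mean_cmult eq)
    also have "\<dots> \<le> h\<^sup>2 * ((\<Sum>s\<in>{i} \<times> {..<L}. m s)\<^sup>2 + card ({i} \<times> {..<L}))"
      using i by (intro mult_left_mono sign_mean_sum_square_le tilt_bounded) auto
    also have "\<dots> = h\<^sup>2 * ((L * (u i / (h * L)))\<^sup>2 + L)"
      by (simp add: eq[symmetric] m)
    also have "\<dots> = (u i)\<^sup>2 + h\<^sup>2 * L"
      using h L_pos by (simp add: field_simps power2_eq_square)
    also have "h\<^sup>2 * L = 1 / q"
      using hq by (metis mult_zero_right nonzero_eq_divide_eq zero_neq_one)
    finally show ?thesis .
  qed
  then have "(\<Sum>i<n. sign_mean grid m (\<lambda>\<epsilon>. (block_sum h L \<epsilon> i)\<^sup>2)) \<le> (\<Sum>i<n. (u i)\<^sup>2 + 1 / q)"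
    by (intro sum_mono) auto
  then show ?thesis
    using u by (simp add: sign_mean_sum sum.distrib)
qed

text \<open>The mean is the sum of the squared tilts, L / (h L)^2 = 1 / (h^2 L) = q. It is the
  entropy price of moving the mean of the random vector to the unit vector \<open>u\<close>.\<close>

lemma sign_mean_tilt_exponent: "sign_mean grid m (\<lambda>\<epsilon>. \<Sum>s\<in>grid. m s * \<epsilon> s) = q"
proof -
  have "sign_mean grid m (\<lambda>\<epsilon>. \<Sum>s\<in>grid. m s * \<epsilon> s) = (\<Sum>s\<in>grid. m s * m s)"
    by (simp add: sign_mean_sum sign_mean_cmult sign_mean_coord)
  also have "\<dots> = (\<Sum>i<n. \<Sum>l<L. (u i)\<^sup>2 / (h * L)\<^sup>2)"
    by (subst sum.cartesian_product) (simp add: m case_prod_beta power2_eq_square)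
  also have "\<dots> = L / (h * L)\<^sup>2"
    using u by (simp flip: sum_divide_distrib sum_distrib_left)
  also have "\<dots> = 1 / (h\<^sup>2 * L)"
    using L_pos by (simp add: power2_eq_square)
  also have "\<dots> = q"
    using hq h L_pos by (simp add: field_simps)
  finally show ?thesis .
qed

end

text \<open>A variational lower bound for an exponential mean: pass from fair to tilted signs, then
  apply Jensen. Under the tilted signs the bilinear form has mean u^T A v by independence of
  \<epsilon> and \<delta>, the penalty has mean at most \<kappa> (1 + n / q) (1 + p / q), and each
  of the two tilts costs q.\<close>

lemma sign_mean_exp_bilinear_ge:
  fixes n p L :: nat and h q :: real
  assumes A: "A \<in> carrier_mat n p"
    and u: "(\<Sum>i<n. (u i)\<^sup>2) = 1" and v: "(\<Sum>j<p. (v j)\<^sup>2) = 1"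
    and h: "0 < h" "1 \<le> h * L" "h\<^sup>2 * L * q = 1" and q: "0 < q" and \<kappa>: "0 \<le> \<kappa>"
  shows "exp (\<theta> * (\<Sum>i<n. u i * mvec A v i) - \<kappa> * ((1 + n / q) * (1 + p / q)) - 2 * q)
    \<le> sign_mean ({..<n} \<times> {..<L}) (\<lambda>_. 0) (\<lambda>\<epsilon>. sign_mean ({..<p} \<times> {..<L}) (\<lambda>_. 0) (\<lambda>\<delta>.
        exp (\<theta> * (\<Sum>i<n. block_sum h L \<epsilon> i * mvec A (block_sum h L \<delta>) i)
          - \<kappa> * ((\<Sum>i<n. (block_sum h L \<epsilon> i)\<^sup>2) * (\<Sum>j<p. (block_sum h L \<delta> j)\<^sup>2)))))"
proof -
  let ?S = "{..<n} \<times> {..<L}" and ?T = "{..<p} \<times> {..<L}"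
  define mu where "mu = (\<lambda>(i, l::nat). u i / (h * L))"
  define mv where "mv = (\<lambda>(i, l::nat). v i / (h * L))"
  define P where "P \<epsilon> = (\<Sum>i<n. (block_sum h L \<epsilon> i)\<^sup>2)" for \<epsilon>
  define Q where "Q \<delta> = (\<Sum>j<p. (block_sum h L \<delta> j)\<^sup>2)" for \<delta>
  define B where "B \<epsilon> \<delta> = (\<Sum>i<n. block_sum h L \<epsilon> i * mvec A (block_sum h L \<delta>) i)" for \<epsilon> \<delta>
  define a where "a \<epsilon> = (\<Sum>s\<in>?S. mu s * \<epsilon> s)" for \<epsilon>
  define b where "b \<delta> = (\<Sum>s\<in>?T. mv s * \<delta> s)" for \<delta>
  define F where "F \<epsilon> \<delta> = \<theta> * B \<epsilon> \<delta> - \<kappa> * (P \<epsilon> * Q \<delta>)" for \<epsilon> \<delta>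
  have fin: "finite ?S" "finite ?T" by auto
  note mu_le = tilt_bounded[OF h u mu_def] and mv_le = tilt_bounded[OF h v mv_def]
  have zero_le: "\<bar>0::real\<bar> \<le> 1" by simp
  have meanP: "sign_mean ?S mu P \<le> 1 + n / q"
    unfolding P_def by (rule sign_mean_block_sum_square[OF h u mu_def])
  have meanQ: "sign_mean ?T mv Q \<le> 1 + p / q"
    unfolding Q_def by (rule sign_mean_block_sum_square[OF h v mv_def])
  have nonnegQ: "0 \<le> sign_mean ?T mv Q"
    using sign_mean_mono[OF fin(2) mv_le, where \<phi> = "\<lambda>_. 0" and \<psi> = Q] fin(2) by (simp add: Q_def sum_nonneg)
  have inner: "sign_mean ?T mv (\<lambda>\<delta>. F \<epsilon> \<delta> - b \<delta>)
      = \<theta> * (\<Sum>i<n. block_sum h L \<epsilon> i * mvec A v i) - \<kappa> * (P \<epsilon> * sign_mean ?T mv Q) - q" for \<epsilon>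
  proof -
    have "sign_mean ?T mv (\<lambda>\<delta>. mvec A (block_sum h L \<delta>) i) = mvec A v i" for i
      unfolding mvec_def sign_mean_sum sign_mean_cmult
      using A by (intro sum.cong refl) (simp add: sign_mean_block_sum[OF h v mv_def])
    then have "sign_mean ?T mv (B \<epsilon>) = (\<Sum>i<n. block_sum h L \<epsilon> i * mvec A v i)"
      unfolding B_def by (simp add: sign_mean_sum sign_mean_cmult)
    moreover have "sign_mean ?T mv b = q"
      unfolding b_def by (rule sign_mean_tilt_exponent[OF h v mv_def])
    ultimately show ?thesis
      unfolding F_def by (simp add: sign_mean_diff sign_mean_cmult)
  qed
  have outer: "sign_mean ?S mu (\<lambda>\<epsilon>. sign_mean ?T mv (\<lambda>\<delta>. F \<epsilon> \<delta> - b \<delta>) - a \<epsilon>)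
      = \<theta> * (\<Sum>i<n. u i * mvec A v i) - \<kappa> * (sign_mean ?S mu P * sign_mean ?T mv Q) - q - q"
  proof -
    have "sign_mean ?S mu (\<lambda>\<epsilon>. \<Sum>i<n. block_sum h L \<epsilon> i * mvec A v i) = (\<Sum>i<n. u i * mvec A v i)"
      by (simp add: sign_mean_sum sign_mean_multc sign_mean_block_sum[OF h u mu_def])
    moreover have "sign_mean ?S mu a = q"
      unfolding a_def by (rule sign_mean_tilt_exponent[OF h u mu_def])
    ultimately show ?thesis
      unfolding inner using fin by (simp add: sign_mean_diff sign_mean_cmult sign_mean_multc)
  qed
  \<comment> \<open>The exponent is now a double tilted mean. Jensen takes exp inside the outer mean
    and then inside the inner one; after that the inner and the outer tilt are removed, absorbing
    the factors \<open>exp (- b \<delta>)\<close> and \<open>exp (- a \<epsilon>)\<close>.\<close>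
  have "exp (\<theta> * (\<Sum>i<n. u i * mvec A v i) - \<kappa> * ((1 + n / q) * (1 + p / q)) - 2 * q)
      \<le> exp (sign_mean ?S mu (\<lambda>\<epsilon>. sign_mean ?T mv (\<lambda>\<delta>. F \<epsilon> \<delta> - b \<delta>) - a \<epsilon>))"
  proof -
    have "sign_mean ?S mu P * sign_mean ?T mv Q \<le> (1 + n / q) * (1 + p / q)"
      using meanP meanQ nonnegQ q by (intro mult_mono) simp_all
    from mult_left_mono[OF this \<kappa>] show ?thesis
      by (simp add: outer)
  qed
  also have "\<dots> \<le> sign_mean ?S mu (\<lambda>\<epsilon>. exp (sign_mean ?T mv (\<lambda>\<delta>. F \<epsilon> \<delta> - b \<delta>) - a \<epsilon>))"
    by (rule exp_sign_mean_le[OF fin(1) mu_le])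
  also have "\<dots> \<le> sign_mean ?S mu (\<lambda>\<epsilon>. sign_mean ?T (\<lambda>_. 0) (\<lambda>\<delta>. exp (F \<epsilon> \<delta>)) * exp (- a \<epsilon>))"
  proof (rule sign_mean_mono[OF fin(1) mu_le])
    fix \<epsilon>
    have "exp (sign_mean ?T mv (\<lambda>\<delta>. F \<epsilon> \<delta> - b \<delta>)) \<le> sign_mean ?T mv (\<lambda>\<delta>. exp (F \<epsilon> \<delta> - b \<delta>))"
      by (rule exp_sign_mean_le[OF fin(2) mv_le])
    also have "\<dots> = sign_mean ?T mv (\<lambda>\<delta>. exp (F \<epsilon> \<delta>) * exp (- b \<delta>))"
      by (simp flip: exp_add)
    also have "\<dots> \<le> sign_mean ?T (\<lambda>_. 0) (\<lambda>\<delta>. exp (F \<epsilon> \<delta>))"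
      unfolding b_def by (rule sign_mean_tilt[OF fin(2) mv_le]) simp_all
    finally have "exp (sign_mean ?T mv (\<lambda>\<delta>. F \<epsilon> \<delta> - b \<delta>)) * exp (- a \<epsilon>)
        \<le> sign_mean ?T (\<lambda>_. 0) (\<lambda>\<delta>. exp (F \<epsilon> \<delta>)) * exp (- a \<epsilon>)"
      by (rule mult_right_mono) simp
    then show "exp (sign_mean ?T mv (\<lambda>\<delta>. F \<epsilon> \<delta> - b \<delta>) - a \<epsilon>)
        \<le> sign_mean ?T (\<lambda>_. 0) (\<lambda>\<delta>. exp (F \<epsilon> \<delta>)) * exp (- a \<epsilon>)"
      by (simp flip: exp_add)
  qed
  also have "\<dots> \<le> sign_mean ?S (\<lambda>_. 0) (\<lambda>\<epsilon>. sign_mean ?T (\<lambda>_. 0) (\<lambda>\<delta>. exp (F \<epsilon> \<delta>)))"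
  proof -
    have "0 \<le> sign_mean ?T (\<lambda>_. 0) (\<lambda>\<delta>. exp (F \<epsilon> \<delta>))" for \<epsilon>
      using sign_mean_mono[OF fin(2) zero_le, where \<phi> = "\<lambda>_. 0" and \<psi> = "\<lambda>\<delta>. exp (F \<epsilon> \<delta>)"] fin(2) by simp
    then show ?thesis
      unfolding a_def by (intro sign_mean_tilt[OF fin(1) mu_le])
  qed
  finally show ?thesis
    unfolding F_def B_def P_def Q_def .
qed

section \<open>Exponential moments of fair signs\<close>

text \<open>Hoeffding's lemma for a variable that is 0 or 2 x with probability 1/2 each bounds the
  logarithm of cosh x by (2 x)^2 / 8. Negative x follow by symmetry.\<close>

lemma cosh_le_exp_half_square:
  fixes x :: real
  shows "(exp x + exp (- x)) / 2 \<le> exp (x\<^sup>2 / 2)"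
proof -
  have pos: "(exp x + exp (- x)) / 2 \<le> exp (x\<^sup>2 / 2)" if "0 \<le> x" for x :: real
  proof -
    have eq: "1 + 1 / 2 * (exp (2 * x) - 1) = exp x * ((exp x + exp (- x)) / 2)"
      by (simp add: field_simps flip: exp_add)
    have "- (2 * x) * (1 / 2) + ln (1 + 1 / 2 * (exp (2 * x) - 1)) \<le> (2 * x)\<^sup>2 / 8"
      using that by (intro Hoeffdings_lemma_aux) simp_all
    then have "ln ((exp x + exp (- x)) / 2) \<le> x\<^sup>2 / 2"
      unfolding eq using add_pos_pos[OF exp_gt_zero[of x] exp_gt_zero[of "- x"]]
      by (subst (asm) ln_mult_pos) (simp_all add: power2_eq_square)
    then have "exp (ln ((exp x + exp (- x)) / 2)) \<le> exp (x\<^sup>2 / 2)"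
      by simp
    then show ?thesis
      by (subst (asm) exp_ln) (auto intro: add_pos_pos)
  qed
  show ?thesis
    using pos[of x] pos[of "- x"] by (cases "0 \<le> x") (simp_all add: add.commute)
qed

text \<open>The exponential moment factors over the signs into hyperbolic cosines, each with a
  Gaussian bound.\<close>

lemma sign_mean_exp_linear_le:
  assumes "finite S"
  shows "sign_mean S (\<lambda>_. 0) (\<lambda>\<epsilon>. exp (\<Sum>s\<in>S. c s * \<epsilon> s)) \<le> exp (\<Sum>s\<in>S. (c s)\<^sup>2 / 2)"
proof -
  have "sign_mean S (\<lambda>_. 0) (\<lambda>\<epsilon>. exp (\<Sum>s\<in>S. c s * \<epsilon> s))
      = (\<Prod>s\<in>S. (exp (c s) + exp (- c s)) / 2)"
    unfolding exp_sum[OF assms]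
    by (subst sign_mean_prod[OF assms, where f = "\<lambda>s e. exp (c s * e)"]) (simp add: add.commute add_divide_distrib)
  also have "\<dots> \<le> (\<Prod>s\<in>S. exp ((c s)\<^sup>2 / 2))"
    by (intro prod_mono conjI cosh_le_exp_half_square) (simp add: add_nonneg_nonneg)
  also have "\<dots> = exp (\<Sum>s\<in>S. (c s)\<^sup>2 / 2)"
    using assms by (simp add: exp_sum)
  finally show ?thesis .
qed

section \<open>Measurability and column rotations\<close>

lemma space_vec_borel [simp]: "space (vec_borel n) = carrier_vec n"
  by (simp add: vec_borel_def)

lemma space_mat_borel [simp]: "space (mat_borel n p) = carrier_mat n p"
  by (simp add: mat_borel_def)

lemma measurable_vec_index [measurable]:
  assumes "i < n"
  shows "(\<lambda>v. vec_index v i) \<in> borel_measurable (vec_borel n)"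
proof -
  have "(\<lambda>v. \<lambda>i\<in>{..<n}. vec_index v i) \<in> vec_borel n \<rightarrow>\<^sub>M (\<Pi>\<^sub>M i\<in>{..<n}. borel)"
    unfolding vec_borel_def by (rule measurable_vimage_algebra1) (auto simp: space_PiM)
  from measurable_component_singleton[of i "{..<n}" "\<lambda>_. borel :: real measure", THEN measurable_compose[OF this]]
  show ?thesis using assms by simp
qed

lemma measurable_mat_index [measurable]:
  assumes "i < n" "j < p"
  shows "(\<lambda>A. A $$ (i, j)) \<in> borel_measurable (mat_borel n p)"
proof -
  have "(\<lambda>A. \<lambda>ij\<in>{..<n} \<times> {..<p}. A $$ ij) \<in> mat_borel n p \<rightarrow>\<^sub>M (\<Pi>\<^sub>M ij\<in>{..<n} \<times> {..<p}. borel)"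
    unfolding mat_borel_def by (rule measurable_vimage_algebra1) (auto simp: space_PiM)
  from measurable_component_singleton[of "(i, j)" "{..<n} \<times> {..<p}" "\<lambda>_. borel :: real measure", THEN measurable_compose[OF this]]
  show ?thesis using assms by simp
qed

lemma measurable_vec_borelI:
  assumes "\<And>x. x \<in> space M \<Longrightarrow> f x \<in> carrier_vec n"
    and "\<And>i. i < n \<Longrightarrow> (\<lambda>x. vec_index (f x) i) \<in> borel_measurable M"
  shows "f \<in> M \<rightarrow>\<^sub>M vec_borel n"
  unfolding vec_borel_def
  by (rule measurable_vimage_algebra2) (use assms in \<open>auto intro!: measurable_restrict\<close>)

lemma measurable_mat_borelI:
  assumes "\<And>x. x \<in> space M \<Longrightarrow> f x \<in> carrier_mat n p"
    and "\<And>i j. i < n \<Longrightarrow> j < p \<Longrightarrow> (\<lambda>x. f x $$ (i, j)) \<in> borel_measurable M"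
  shows "f \<in> M \<rightarrow>\<^sub>M mat_borel n p"
  unfolding mat_borel_def
  by (rule measurable_vimage_algebra2) (use assms in \<open>auto intro!: measurable_restrict\<close>)

section \<open>The group of column rotations and its action\<close>

lemma orthogonal_mats_carrier: "U \<in> orthogonal_mats n \<Longrightarrow> U \<in> carrier_mat n n"
  by (simp add: orthogonal_mats_def)

lemma space_column_rotations_borel [simp]:
  "space (column_rotations_borel n p) = (\<Pi>\<^sub>E j\<in>{..<p}. orthogonal_mats n)"
proof -
  have "orthogonal_mats n \<inter> carrier_mat n n = orthogonal_mats n"
    by (auto simp: orthogonal_mats_def)
  then show ?thesis
    by (simp add: column_rotations_borel_def space_PiM space_restrict_space)
qed

lemma carrier_column_rotations [simp]:
  "carrier (column_rotations n p) = (\<Pi>\<^sub>E j\<in>{..<p}. orthogonal_mats n)"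
  by (simp add: column_rotations_def orthogonal_group_def)

lemma mult_column_rotations [simp]:
  "g \<otimes>\<^bsub>column_rotations n p\<^esub> h = (\<lambda>j\<in>{..<p}. g j * h j)"
  by (simp add: column_rotations_def orthogonal_group_def product_group_def)

lemma measurable_rotation_entry [measurable]:
  assumes "j < p" "i < n" "k < n"
  shows "(\<lambda>U. U j $$ (i, k)) \<in> borel_measurable (column_rotations_borel n p)"
proof -
  have "(\<lambda>U. U j) \<in> column_rotations_borel n p \<rightarrow>\<^sub>M restrict_space (mat_borel n n) (orthogonal_mats n)"
    using assms(1) unfolding column_rotations_borel_def by (intro measurable_component_singleton) auto
  from measurable_compose[OF this measurable_restrict_space1[OF measurable_mat_index[OF assms(2,3)]]]
  show ?thesis .
qed

lemma orthogonal_mats_mult: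
  assumes "U \<in> orthogonal_mats n" "V \<in> orthogonal_mats n"
  shows "U * V \<in> orthogonal_mats n"
proof -
  have c: "U \<in> carrier_mat n n" "V \<in> carrier_mat n n" and o: "transpose_mat U * U = 1\<^sub>m n" "transpose_mat V * V = 1\<^sub>m n"
    using assms by (auto simp: orthogonal_mats_def)
  have "transpose_mat (U * V) * (U * V) = transpose_mat V * (transpose_mat U * U) * V"
    using c by (subst transpose_mult[OF c]) (simp add: assoc_mult_mat[of _ n n _ n _ n])
  then show ?thesis
    using c o by (simp add: orthogonal_mats_def)
qed

text \<open>Entries of the product are linear in the entries of \<open>h\<close>. Measurability is
  what allows laws to be pushed forward along left translations.\<close>

lemma measurable_left_mult_rotation:
  assumes g: "g \<in> carrier (column_rotations n p)"
  shows "(\<lambda>h. g \<otimes>\<^bsub>column_rotations n p\<^esub> h) \<in> column_rotations_borel n p \<rightarrow>\<^sub>M column_rotations_borel n p"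
proof -
  have gj: "g j \<in> orthogonal_mats n" if "j < p" for j
    using g that by auto
  have "(\<lambda>h. \<lambda>j\<in>{..<p}. g j * h j) \<in> column_rotations_borel n p \<rightarrow>\<^sub>M (\<Pi>\<^sub>M j\<in>{..<p}. restrict_space (mat_borel n n) (orthogonal_mats n))"
  proof (intro measurable_restrict measurable_restrict_space2 measurable_mat_borelI)
    fix j assume "j \<in> {..<p}"
    then have j: "j < p" by simp
    show "(\<lambda>h. g j * h j) \<in> space (column_rotations_borel n p) \<rightarrow> orthogonal_mats n"
      using gj[OF j] j by (auto intro!: orthogonal_mats_mult)
    show "g j * h j \<in> carrier_mat n n" if "h \<in> space (column_rotations_borel n p)" for h
      using gj[OF j] j that by (intro orthogonal_mats_carrier orthogonal_mats_mult) auto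
    show "(\<lambda>h. (g j * h j) $$ (i, k)) \<in> borel_measurable (column_rotations_borel n p)" if "i < n" "k < n" for i k
    proof -
      have "(\<lambda>h. \<Sum>l<n. g j $$ (i, l) * h j $$ (l, k)) \<in> borel_measurable (column_rotations_borel n p)"
        using j that by (intro borel_measurable_sum borel_measurable_times borel_measurable_const measurable_rotation_entry) auto
      moreover have "(g j * h j) $$ (i, k) = (\<Sum>l<n. g j $$ (i, l) * h j $$ (l, k))"
        if "h \<in> space (column_rotations_borel n p)" for h
      proof -
        have "g j \<in> carrier_mat n n" "h j \<in> carrier_mat n n"
          using that j gj[OF j] by (auto intro: orthogonal_mats_carrier)
        then show ?thesis
          using \<open>i < n\<close> \<open>k < n\<close> by (auto simp: scalar_prod_def lessThan_atLeast0 intro!: sum.cong)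
      qed
      ultimately show ?thesis
        by (subst measurable_cong) auto
    qed
  qed
  then show ?thesis by (simp add: column_rotations_borel_def)
qed

lemma rotate_columns_carrier [simp]: "rotate_columns n p U A \<in> carrier_mat n p"
  unfolding rotate_columns_def using mat_of_cols_carrier(1)[of n "map (\<lambda>j. U j *\<^sub>v col A j) [0..<p]"] by simp

lemma dim_rotate_columns [simp]:
  "dim_row (rotate_columns n p U A) = n" "dim_col (rotate_columns n p U A) = p"
  using rotate_columns_carrier[of n p U A] unfolding carrier_mat_def by auto

lemma col_rotate_columns:
  assumes "j < p" "U j \<in> carrier_mat n n"
  shows "col (rotate_columns n p U A) j = U j *\<^sub>v col A j"
  unfolding rotate_columns_def using assms by (subst col_mat_of_cols) (auto intro: carrier_vecI)

lemma rotate_columns_index: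
  assumes "i < n" "j < p" "U j \<in> carrier_mat n n" "A \<in> carrier_mat n p"
  shows "rotate_columns n p U A $$ (i, j) = (\<Sum>k<n. U j $$ (i, k) * A $$ (k, j))"
  unfolding rotate_columns_def using assms
  by (subst mat_of_cols_index) (auto simp: scalar_prod_def lessThan_atLeast0 intro!: sum.cong)

text \<open>The action law, through which left invariance of Haar measure becomes invariance of the
  rotated data.\<close>

lemma rotate_columns_mult:
  assumes "g \<in> carrier (column_rotations n p)" "U \<in> carrier (column_rotations n p)" "A \<in> carrier_mat n p"
  shows "rotate_columns n p (g \<otimes>\<^bsub>column_rotations n p\<^esub> U) A = rotate_columns n p g (rotate_columns n p U A)"
proof -
  have "(g \<otimes>\<^bsub>column_rotations n p\<^esub> U) j *\<^sub>v col A j = g j *\<^sub>v col (rotate_columns n p U A) j" if "j < p" for j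
  proof -
    have "g j \<in> carrier_mat n n" "U j \<in> carrier_mat n n"
      using assms(1,2) that by (auto intro: orthogonal_mats_carrier)
    then show ?thesis
      using that assms(3) by (simp add: col_rotate_columns assoc_mult_mat_vec[of _ n n _ n])
  qed
  then show ?thesis
    unfolding rotate_columns_def by (intro arg_cong[of _ _ "mat_of_cols n"] map_cong) (auto simp: rotate_columns_def)
qed

lemma measurable_rotate_columns:
  assumes "X \<in> M \<rightarrow>\<^sub>M mat_borel n p" "H \<in> M \<rightarrow>\<^sub>M column_rotations_borel n p"
  shows "(\<lambda>\<omega>. rotate_columns n p (H \<omega>) (X \<omega>)) \<in> M \<rightarrow>\<^sub>M mat_borel n p"
proof (rule measurable_mat_borelI)
  fix i j assume ij: "i < n" "j < p"
  have "(\<lambda>\<omega>. \<Sum>k<n. H \<omega> j $$ (i, k) * X \<omega> $$ (k, j)) \<in> borel_measurable M"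
    using ij
    by (intro borel_measurable_sum borel_measurable_times
        measurable_compose[OF assms(2) measurable_rotation_entry] measurable_compose[OF assms(1) measurable_mat_index]) auto
  moreover have "rotate_columns n p (H \<omega>) (X \<omega>) $$ (i, j) = (\<Sum>k<n. H \<omega> j $$ (i, k) * X \<omega> $$ (k, j))"
    if "\<omega> \<in> space M" for \<omega>
    using ij measurable_space[OF assms(1) that] measurable_space[OF assms(2) that]
    by (intro rotate_columns_index) (auto intro: orthogonal_mats_carrier)
  ultimately show "(\<lambda>\<omega>. rotate_columns n p (H \<omega>) (X \<omega>) $$ (i, j)) \<in> borel_measurable M"
    by (subst measurable_cong) auto
qed simp

lemma measurable_mat_add:
  assumes "s \<in> carrier_mat n p" "X \<in> M \<rightarrow>\<^sub>M mat_borel n p"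
  shows "(\<lambda>\<omega>. s + X \<omega>) \<in> M \<rightarrow>\<^sub>M mat_borel n p"
proof (rule measurable_mat_borelI)
  fix i j assume ij: "i < n" "j < p"
  have "(\<lambda>\<omega>. s $$ (i, j) + X \<omega> $$ (i, j)) \<in> borel_measurable M"
    using ij by (intro borel_measurable_add borel_measurable_const measurable_compose[OF assms(2) measurable_mat_index])
  moreover have "(s + X \<omega>) $$ (i, j) = s $$ (i, j) + X \<omega> $$ (i, j)" if "\<omega> \<in> space M" for \<omega>
    using ij assms(1) measurable_space[OF assms(2) that] by auto
  ultimately show "(\<lambda>\<omega>. (s + X \<omega>) $$ (i, j)) \<in> borel_measurable M"
    by (subst measurable_cong) auto
next
  fix \<omega> assume "\<omega> \<in> space M"
  then show "s + X \<omega> \<in> carrier_mat n p"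
    using assms(1) measurable_space[OF assms(2)] by auto
qed

section \<open>Column norms, rotations and measurability of both matrix norms\<close>

lemma eucl_norm_nonneg [simp]: "0 \<le> eucl_norm v"
  by (simp add: eucl_norm_def)

lemma eucl_norm_eq: "eucl_norm v = sqrt (v \<bullet> v)"
  by (simp add: eucl_norm_def L2_set_def scalar_prod_def lessThan_atLeast0 power2_eq_square)

lemma eucl_norm_square: "(eucl_norm v)\<^sup>2 = (\<Sum>i<dim_vec v. (vec_index v i)\<^sup>2)"
  by (simp add: eucl_norm_def L2_set_def sum_nonneg)

lemma eucl_norm_orthogonal:
  assumes U: "U \<in> orthogonal_mats n" and x: "x \<in> carrier_vec n"
  shows "eucl_norm (U *\<^sub>v x) = eucl_norm x"
proof -
  have c: "U \<in> carrier_mat n n" and o: "transpose_mat U * U = 1\<^sub>m n"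
    using U by (auto simp: orthogonal_mats_def)
  have "(U *\<^sub>v x) \<bullet> (U *\<^sub>v x) = (transpose_mat U *\<^sub>v (U *\<^sub>v x)) \<bullet> x"
    using c x by (intro transpose_vec_mult_scalar[symmetric]) auto
  also have "transpose_mat U *\<^sub>v (U *\<^sub>v x) = transpose_mat U * U *\<^sub>v x"
    using c x by (intro assoc_mult_mat_vec[symmetric]) auto
  finally show ?thesis
    using o x by (simp add: eucl_norm_eq)
qed

lemma two_inf_norm_le_iff:
  assumes "A \<in> carrier_mat n p" "0 < p"
  shows "two_inf_norm A \<le> b \<longleftrightarrow> (\<forall>j<p. eucl_norm (col A j) \<le> b)"
proof -
  have "two_inf_norm A \<le> b \<longleftrightarrow> (\<forall>a\<in>(\<lambda>j. eucl_norm (col A j)) ` {..<p}. a \<le> b)"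
    unfolding two_inf_norm_def using assms by (subst Max_le_iff) auto
  then show ?thesis by auto
qed

lemma eucl_norm_col_le: "A \<in> carrier_mat n p \<Longrightarrow> j < p \<Longrightarrow> eucl_norm (col A j) \<le> two_inf_norm A"
  using two_inf_norm_le_iff[of A n p "two_inf_norm A"] by auto

lemma two_inf_norm_nonneg:
  assumes "A \<in> carrier_mat n p" "0 < p"
  shows "0 \<le> two_inf_norm A"
  using eucl_norm_col_le[OF assms] eucl_norm_nonneg order_trans by blast

lemma two_inf_norm_add_le:
  assumes A: "A \<in> carrier_mat n p" and B: "B \<in> carrier_mat n p" and p: "0 < p"
  shows "two_inf_norm (A + B) \<le> two_inf_norm A + two_inf_norm B"
proof -
  have "eucl_norm (col (A + B) j) \<le> two_inf_norm A + two_inf_norm B" if j: "j < p" for j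
  proof -
    have "eucl_norm (col (A + B) j) = L2_set (\<lambda>i. vec_index (col A j) i + vec_index (col B j) i) {..<n}"
      unfolding eucl_norm_def using A B j by (intro L2_set_cong) auto
    also have "\<dots> \<le> eucl_norm (col A j) + eucl_norm (col B j)"
      using L2_set_triangle_ineq A B by (simp add: eucl_norm_def)
    also have "\<dots> \<le> two_inf_norm A + two_inf_norm B"
      using A B j by (intro add_mono eucl_norm_col_le)
    finally show ?thesis .
  qed
  then show ?thesis
    using A B p by (subst two_inf_norm_le_iff[of _ n p]) auto
qed

lemma two_inf_norm_rotate_columns:
  assumes U: "U \<in> carrier (column_rotations n p)" and A: "A \<in> carrier_mat n p"
  shows "two_inf_norm (rotate_columns n p U A) = two_inf_norm A"
proof -
  have "eucl_norm (col (rotate_columns n p U A) j) = eucl_norm (col A j)" if "j < p" for j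
  proof -
    have "U j \<in> orthogonal_mats n" using U that by auto
    then show ?thesis
      using A that by (subst col_rotate_columns) (auto intro: orthogonal_mats_carrier eucl_norm_orthogonal)
  qed
  then show ?thesis
    unfolding two_inf_norm_def using A by (auto intro!: arg_cong[of _ _ Max] image_cong)
qed

lemma two_inf_norm_measurable:
  assumes p: "0 < p"
  shows "two_inf_norm \<in> borel_measurable (mat_borel n p)"
proof (rule borel_measurableI_le)
  fix b
  have *: "(\<lambda>A. sqrt (\<Sum>i<n. (A $$ (i, j))\<^sup>2)) \<in> borel_measurable (mat_borel n p)" if "j < p" for j
    using that
    by (intro measurable_compose[OF _ borel_measurable_sqrt] borel_measurable_sum borel_measurable_power
        measurable_mat_index) auto
  have "{A \<in> space (mat_borel n p). \<forall>j\<in>{..<p}. sqrt (\<Sum>i<n. (A $$ (i, j))\<^sup>2) \<le> b} \<in> sets (mat_borel n p)"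
    using * by (intro sets.sets_Collect_finite_All borel_measurable_le borel_measurable_const) auto
  also have "{A \<in> space (mat_borel n p). \<forall>j\<in>{..<p}. sqrt (\<Sum>i<n. (A $$ (i, j))\<^sup>2) \<le> b}
      = {A \<in> space (mat_borel n p). two_inf_norm A \<le> b}"
    using p by (auto simp: two_inf_norm_le_iff[of _ n p] eucl_norm_def L2_set_def)
  finally show "{A \<in> space (mat_borel n p). two_inf_norm A \<le> b} \<in> sets (mat_borel n p)" .
qed

text \<open>A strict inequality at a real maximiser persists at nearby rational vectors, so the
  quantifier ranges over a countable set and \<open>op_norm\<close> becomes measurable. The
  inequality is kept homogeneous because normalising a rational vector may leave the
  rationals.\<close>

lemma op_norm_gt_iff:
  assumes A: "A \<in> carrier_mat n p" and p: "0 < p" and a: "0 \<le> a"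
  shows "a < op_norm A \<longleftrightarrow>
    (\<exists>w\<in>{..<p} \<rightarrow>\<^sub>E \<rat>. a\<^sup>2 * (\<Sum>j<p. (w j)\<^sup>2) < (\<Sum>i<n. (mvec A w i)\<^sup>2))"
proof
  assume less: "a < op_norm A"
  obtain v where v: "(\<Sum>j<p. (v j)\<^sup>2) = 1" "(\<Sum>i<n. (mvec A v i)\<^sup>2) = (op_norm A)\<^sup>2"
    using op_norm_attained[OF A p] by blast
  define f where "f w = (\<Sum>i<n. (mvec A w i)\<^sup>2) - a\<^sup>2 * (\<Sum>j<p. (w j)\<^sup>2)" for w
  \<comment> \<open>Rational approximations of each coordinate from above, with error below 1 / (k +
    1).\<close>
  have "\<exists>x. x \<in> \<rat> \<and> v j < x \<and> x < v j + 1 / Suc k" for j k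
    using Rats_dense_in_real[of "v j" "v j + 1 / Suc k"] by auto
  then obtain x where x: "\<And>j k. x j k \<in> \<rat>" "\<And>j k. v j < x j k" "\<And>j k. x j k < v j + 1 / Suc k"
    by metis
  have lim: "(\<lambda>k. x j k) \<longlonglongrightarrow> v j" for j
  proof (rule tendsto_sandwich[of "\<lambda>_. v j" "x j" _ "\<lambda>k. v j + 1 / Suc k"])
    show "(\<lambda>k. v j + 1 / Suc k) \<longlonglongrightarrow> v j"
      using tendsto_add[OF tendsto_const[of "v j"] LIMSEQ_inverse_real_of_nat]
      by (simp add: inverse_eq_divide)
    show "\<forall>\<^sub>F k in sequentially. v j \<le> x j k"
      using x(2) by (intro always_eventually allI less_imp_le)
    show "\<forall>\<^sub>F k in sequentially. x j k \<le> v j + 1 / Suc k"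
      using x(3) by (intro always_eventually allI less_imp_le)
  qed simp
  have "(\<lambda>k. f (\<lambda>j. x j k)) \<longlonglongrightarrow> f v"
    unfolding f_def mvec_def by (intro tendsto_intros lim)
  moreover have "0 < f v"
    using less a v by (simp add: f_def power_strict_mono)
  ultimately have "\<forall>\<^sub>F k in sequentially. 0 < f (\<lambda>j. x j k)"
    by (rule order_tendstoD)
  then obtain k where k: "0 < f (\<lambda>j. x j k)"
    by (auto dest: eventually_happens)
  \<comment> \<open>Restricting to the first \<open>p\<close> coordinates places the vector in the
    countable set of extensional functions without changing its image under
    \<open>A\<close>.\<close>
  define w where "w = (\<lambda>j\<in>{..<p}. x j k)"
  have "mvec A w i = mvec A (\<lambda>j. x j k) i" for i
    unfolding mvec_def using A by (intro sum.cong) (auto simp: w_def)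
  moreover have "(\<Sum>j<p. (w j)\<^sup>2) = (\<Sum>j<p. (x j k)\<^sup>2)"
    by (simp add: w_def)
  ultimately have "a\<^sup>2 * (\<Sum>j<p. (w j)\<^sup>2) < (\<Sum>i<n. (mvec A w i)\<^sup>2)"
    using k by (simp add: f_def)
  moreover have "w \<in> {..<p} \<rightarrow>\<^sub>E \<rat>"
    using x(1) by (simp add: w_def)
  ultimately show "\<exists>w\<in>{..<p} \<rightarrow>\<^sub>E \<rat>. a\<^sup>2 * (\<Sum>j<p. (w j)\<^sup>2) < (\<Sum>i<n. (mvec A w i)\<^sup>2)"
    by (rule bexI)
next
  assume "\<exists>w\<in>{..<p} \<rightarrow>\<^sub>E \<rat>. a\<^sup>2 * (\<Sum>j<p. (w j)\<^sup>2) < (\<Sum>i<n. (mvec A w i)\<^sup>2)"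
  then obtain w where w: "a\<^sup>2 * (\<Sum>j<p. (w j)\<^sup>2) < (\<Sum>i<n. (mvec A w i)\<^sup>2)"
    by (rule bexE)
  obtain v where v: "0 \<le> op_norm A"
      "(\<Sum>i<n. (mvec A w i)\<^sup>2) \<le> (op_norm A)\<^sup>2 * (\<Sum>j<p. (w j)\<^sup>2)"
    using op_norm_attained[OF A p] by blast
  have "a\<^sup>2 * (\<Sum>j<p. (w j)\<^sup>2) < (op_norm A)\<^sup>2 * (\<Sum>j<p. (w j)\<^sup>2)"
    using w v(2) by (rule less_le_trans)
  then have "a\<^sup>2 < (op_norm A)\<^sup>2"
    by (rule mult_right_less_imp_less) (simp add: sum_nonneg)
  then show "a < op_norm A"
    using v(1) by (rule power_less_imp_less_base)
qed

lemma op_norm_measurable: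
  assumes p: "0 < p"
  shows "op_norm \<in> borel_measurable (mat_borel n p)"
proof (rule borel_measurableI_greater)
  fix a
  show "{A \<in> space (mat_borel n p). a < op_norm A} \<in> sets (mat_borel n p)"
  proof (cases "0 \<le> a")
    \<comment> \<open>The rational criterion covers thresholds that are at least 0; a negative one
      is exceeded by every operator norm.\<close>
    case False
    then have "a < op_norm A" if "A \<in> carrier_mat n p" for A
      using op_norm_nonneg[OF that p] by linarith
    then have "{A \<in> space (mat_borel n p). a < op_norm A} = space (mat_borel n p)"
      by auto
    then show ?thesis by (simp only: sets.top)
  next
    case True
    have meas: "(\<lambda>A. \<Sum>i<n. (\<Sum>j<p. A $$ (i, j) * w j)\<^sup>2) \<in> borel_measurable (mat_borel n p)" for w
      by (intro borel_measurable_sum borel_measurable_power borel_measurable_times borel_measurable_const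
          measurable_mat_index) auto
    have "countable ({..<p} \<rightarrow>\<^sub>E (\<rat> :: real set))"
      by (intro countable_PiE countable_rat) simp_all
    then have "{A \<in> space (mat_borel n p). \<exists>w\<in>{..<p} \<rightarrow>\<^sub>E \<rat>.
        a\<^sup>2 * (\<Sum>j<p. (w j)\<^sup>2) < (\<Sum>i<n. (\<Sum>j<p. A $$ (i, j) * w j)\<^sup>2)} \<in> sets (mat_borel n p)"
      by (intro sets.sets_Collect_countable_Ex' borel_measurable_less borel_measurable_const meas)
    also have "{A \<in> space (mat_borel n p). \<exists>w\<in>{..<p} \<rightarrow>\<^sub>E \<rat>.
        a\<^sup>2 * (\<Sum>j<p. (w j)\<^sup>2) < (\<Sum>i<n. (\<Sum>j<p. A $$ (i, j) * w j)\<^sup>2)}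
      = {A \<in> space (mat_borel n p). a < op_norm A}"
    proof (intro Collect_cong conj_cong refl)
      fix A assume "A \<in> space (mat_borel n p)"
      then have A: "A \<in> carrier_mat n p" by simp
      then show "(\<exists>w\<in>{..<p} \<rightarrow>\<^sub>E \<rat>. a\<^sup>2 * (\<Sum>j<p. (w j)\<^sup>2) < (\<Sum>i<n. (\<Sum>j<p. A $$ (i, j) * w j)\<^sup>2))
          \<longleftrightarrow> a < op_norm A"
        by (simp add: op_norm_gt_iff[OF A p True] mvec_def)
    qed
    finally show ?thesis .
  qed
qed

section \<open>Independence and joint laws\<close>

text \<open>Independence gives the product formula on measurable rectangles, and these determine the
  product measure.\<close>

lemma indep_rvs_distr_pair:
  assumes "prob_space M" and indep: "indep_rvs M A X B Y"
  shows "distr M (A \<Otimes>\<^sub>M B) (\<lambda>\<omega>. (X \<omega>, Y \<omega>)) = distr M A X \<Otimes>\<^sub>M distr M B Y"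
proof -
  interpret prob_space M by fact
  have X: "X \<in> M \<rightarrow>\<^sub>M A" and Y: "Y \<in> M \<rightarrow>\<^sub>M B"
    and ind: "indep_set {X -` S \<inter> space M | S. S \<in> sets A} {Y -` S \<inter> space M | S. S \<in> sets B}"
    using indep by (auto simp: indep_rvs_def)
  interpret PX: prob_space "distr M A X" by (rule prob_space_distr[OF X])
  interpret PY: prob_space "distr M B Y" by (rule prob_space_distr[OF Y])
  show ?thesis
  proof (rule pair_measure_eqI[symmetric])
    show "sigma_finite_measure (distr M A X)" "sigma_finite_measure (distr M B Y)" by unfold_locales
    show "sets (distr M A X \<Otimes>\<^sub>M distr M B Y) = sets (distr M (A \<Otimes>\<^sub>M B) (\<lambda>\<omega>. (X \<omega>, Y \<omega>)))"
      by (simp cong: sets_pair_measure_cong)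
    fix S T assume "S \<in> sets (distr M A X)" "T \<in> sets (distr M B Y)"
    then have S: "S \<in> sets A" and T: "T \<in> sets B" by simp_all
    have "emeasure (distr M (A \<Otimes>\<^sub>M B) (\<lambda>\<omega>. (X \<omega>, Y \<omega>))) (S \<times> T)
        = emeasure M ((\<lambda>\<omega>. (X \<omega>, Y \<omega>)) -` (S \<times> T) \<inter> space M)"
      using X Y S T by (intro emeasure_distr measurable_Pair pair_measureI)
    also have "(\<lambda>\<omega>. (X \<omega>, Y \<omega>)) -` (S \<times> T) \<inter> space M = (X -` S \<inter> space M) \<inter> (Y -` T \<inter> space M)"
      by auto
    also have "emeasure M \<dots> = ennreal (prob (X -` S \<inter> space M) * prob (Y -` T \<inter> space M))"
      unfolding emeasure_eq_measure using indep_setD[OF ind, of "X -` S \<inter> space M" "Y -` T \<inter> space M"] S T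
      by auto
    also have "\<dots> = emeasure M (X -` S \<inter> space M) * emeasure M (Y -` T \<inter> space M)"
      by (simp add: emeasure_eq_measure ennreal_mult)
    also have "\<dots> = emeasure (distr M A X) S * emeasure (distr M B Y) T"
      using X Y S T by (simp add: emeasure_distr)
    finally show "emeasure (distr M A X) S * emeasure (distr M B Y) T
        = emeasure (distr M (A \<Otimes>\<^sub>M B) (\<lambda>\<omega>. (X \<omega>, Y \<omega>))) (S \<times> T)" ..
  qed
qed

lemma vimage_sets_compose_subset:
  assumes X: "X \<in> M \<rightarrow>\<^sub>M A" and f: "f \<in> A \<rightarrow>\<^sub>M B"
  shows "{(\<lambda>\<omega>. f (X \<omega>)) -` S \<inter> space M | S. S \<in> sets B} \<subseteq> {X -` S \<inter> space M | S. S \<in> sets A}"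
proof safe
  fix S assume S: "S \<in> sets B"
  have "(\<lambda>\<omega>. f (X \<omega>)) -` S \<inter> space M = X -` (f -` S \<inter> space A) \<inter> space M"
    using measurable_space[OF X] by auto
  then show "\<exists>S'. (\<lambda>\<omega>. f (X \<omega>)) -` S \<inter> space M = X -` S' \<inter> space M \<and> S' \<in> sets A"
    using measurable_sets[OF f S] by blast
qed

text \<open>Measurable images generate smaller \<sigma>-algebras, and independence passes to
  subfamilies.\<close>

lemma indep_rvs_compose:
  assumes "prob_space M" and indep: "indep_rvs M A X B Y" and f: "f \<in> A \<rightarrow>\<^sub>M A'" and g: "g \<in> B \<rightarrow>\<^sub>M B'"
  shows "indep_rvs M A' (\<lambda>\<omega>. f (X \<omega>)) B' (\<lambda>\<omega>. g (Y \<omega>))"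
proof -
  interpret prob_space M by fact
  have X: "X \<in> M \<rightarrow>\<^sub>M A" and Y: "Y \<in> M \<rightarrow>\<^sub>M B"
    and ind: "indep_set {X -` S \<inter> space M | S. S \<in> sets A} {Y -` S \<inter> space M | S. S \<in> sets B}"
    using indep by (auto simp: indep_rvs_def)
  have mono: "indep_set \<A>' \<B>'" if "\<A>' \<subseteq> \<A>" "\<B>' \<subseteq> \<B>" "indep_set \<A> \<B>" for \<A> \<B> \<A>' \<B>'
    using that unfolding indep_sets2_eq by blast
  show ?thesis
    using measurable_compose[OF X f] measurable_compose[OF Y g]
      mono[OF vimage_sets_compose_subset[OF X f] vimage_sets_compose_subset[OF Y g] ind]
    by (simp add: indep_rvs_def)
qed

section \<open>Random matrices with rotation invariant law\<close>

text \<open>The property of the law shared by the noise and the randomly rotated data, on which the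
  tail bound rests.\<close>

definition rotation_invariant :: "'w measure \<Rightarrow> nat \<Rightarrow> nat \<Rightarrow> ('w \<Rightarrow> real mat) \<Rightarrow> bool" where
  "rotation_invariant M n p Y \<longleftrightarrow> Y \<in> M \<rightarrow>\<^sub>M mat_borel n p \<and>
     (\<forall>g\<in>carrier (column_rotations n p).
       distr M (mat_borel n p) (\<lambda>\<omega>. rotate_columns n p g (Y \<omega>)) = distr M (mat_borel n p) Y)"

lemma measurable_mult_mat_vec:
  assumes "U \<in> carrier_mat n n"
  shows "(\<lambda>x. U *\<^sub>v x) \<in> vec_borel n \<rightarrow>\<^sub>M vec_borel n"
proof (rule measurable_vec_borelI)
  fix i assume i: "i < n"
  have "(\<lambda>x. \<Sum>k<n. U $$ (i, k) * vec_index x k) \<in> borel_measurable (vec_borel n)"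
    by (intro borel_measurable_sum borel_measurable_times borel_measurable_const measurable_vec_index) simp
  moreover have "vec_index (U *\<^sub>v x) i = (\<Sum>k<n. U $$ (i, k) * vec_index x k)" if "x \<in> space (vec_borel n)" for x
    using assms i that by (auto simp: scalar_prod_def lessThan_atLeast0 intro!: sum.cong)
  ultimately show "(\<lambda>x. vec_index (U *\<^sub>v x) i) \<in> borel_measurable (vec_borel n)"
    by (subst measurable_cong) auto
qed (use assms in auto)

text \<open>By independence the joint law of the columns is the product of their laws, and each
  factor is unchanged by its own rotation.\<close>

lemma rotation_invariant_spherical_columns:
  assumes "prob_space M" and N: "N \<in> M \<rightarrow>\<^sub>M mat_borel n p" and p: "0 < p"
    and indep: "prob_space.indep_vars M (\<lambda>_. vec_borel n) (\<lambda>j \<omega>. col (N \<omega>) j) {..<p}"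
    and spherical: "\<And>j. j < p \<Longrightarrow> spherical M n (\<lambda>\<omega>. col (N \<omega>) j)"
  shows "rotation_invariant M n p N"
proof -
  interpret prob_space M by fact
  let ?P = "\<Pi>\<^sub>M j\<in>{..<p}. vec_borel n"
  \<comment> \<open>\<Phi> reassembles a tuple of columns into a matrix, so that laws of matrices
    are images of laws of tuples.\<close>
  define \<Phi> where "\<Phi> c = mat n p (\<lambda>(i, j). vec_index (c j) i)" for c :: "nat \<Rightarrow> real vec"
  have \<Phi>: "\<Phi> \<in> ?P \<rightarrow>\<^sub>M mat_borel n p"
  proof (rule measurable_mat_borelI)
    fix i j assume ij: "i < n" "j < p"
    have "(\<lambda>c. vec_index (c j) i) \<in> borel_measurable ?P"
      using ij
      by (intro measurable_compose[OF measurable_component_singleton[of j "{..<p}" "\<lambda>_. vec_borel n"]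
            measurable_vec_index]) auto
    then show "(\<lambda>c. \<Phi> c $$ (i, j)) \<in> borel_measurable ?P"
      using ij by (simp add: \<Phi>_def)
  qed (simp add: \<Phi>_def)
  have colN: "(\<lambda>\<omega>. col (N \<omega>) j) \<in> M \<rightarrow>\<^sub>M vec_borel n" if "j < p" for j
    using spherical[OF that] by (simp add: spherical_def)
  have ne: "{..<p} \<noteq> {}" using p by auto
  have "distr M (mat_borel n p) (\<lambda>\<omega>. rotate_columns n p g (N \<omega>)) = distr M (mat_borel n p) N"
    if g: "g \<in> carrier (column_rotations n p)" for g
  proof -
    have gj: "g j \<in> orthogonal_mats n" "g j \<in> carrier_mat n n" if "j < p" for j
      using g that by (auto intro: orthogonal_mats_carrier)
    have gcol: "(\<lambda>\<omega>. g j *\<^sub>v col (N \<omega>) j) \<in> M \<rightarrow>\<^sub>M vec_borel n" if "j < p" for j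
      using measurable_compose[OF colN[OF that] measurable_mult_mat_vec[OF gj(2)[OF that]]] .
    have indep': "indep_vars (\<lambda>_. vec_borel n) (\<lambda>j \<omega>. g j *\<^sub>v col (N \<omega>) j) {..<p}"
      by (rule indep_vars_compose2[OF indep]) (simp add: measurable_mult_mat_vec gj)
    have "distr M ?P (\<lambda>\<omega>. \<lambda>j\<in>{..<p}. g j *\<^sub>v col (N \<omega>) j)
        = (\<Pi>\<^sub>M j\<in>{..<p}. distr M (vec_borel n) (\<lambda>\<omega>. g j *\<^sub>v col (N \<omega>) j))"
      using indep' gcol by (subst (asm) indep_vars_iff_distr_eq_PiM'[OF ne]) auto
    also have "\<dots> = (\<Pi>\<^sub>M j\<in>{..<p}. distr M (vec_borel n) (\<lambda>\<omega>. col (N \<omega>) j))"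
      using spherical gj(1) by (intro PiM_cong refl) (auto simp: spherical_def)
    also have "\<dots> = distr M ?P (\<lambda>\<omega>. \<lambda>j\<in>{..<p}. col (N \<omega>) j)"
      using indep colN by (subst (asm) indep_vars_iff_distr_eq_PiM'[OF ne]) auto
    finally have eq: "distr M ?P (\<lambda>\<omega>. \<lambda>j\<in>{..<p}. g j *\<^sub>v col (N \<omega>) j)
        = distr M ?P (\<lambda>\<omega>. \<lambda>j\<in>{..<p}. col (N \<omega>) j)" .
    have "distr M (mat_borel n p) (\<lambda>\<omega>. rotate_columns n p g (N \<omega>))
        = distr M (mat_borel n p) (\<lambda>\<omega>. \<Phi> (\<lambda>j\<in>{..<p}. g j *\<^sub>v col (N \<omega>) j))"
    proof (rule distr_cong)
      fix \<omega> assume "\<omega> \<in> space M"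
      then have "N \<omega> \<in> carrier_mat n p" using measurable_space[OF N] by simp
      then show "rotate_columns n p g (N \<omega>) = \<Phi> (\<lambda>j\<in>{..<p}. g j *\<^sub>v col (N \<omega>) j)"
        using gj by (intro eq_matI) (auto simp: \<Phi>_def rotate_columns_def mat_of_cols_index)
    qed simp_all
    also have "\<dots> = distr (distr M ?P (\<lambda>\<omega>. \<lambda>j\<in>{..<p}. g j *\<^sub>v col (N \<omega>) j)) (mat_borel n p) \<Phi>"
      using gcol by (subst distr_distr[OF \<Phi>]) (auto simp: comp_def intro!: measurable_restrict)
    also have "\<dots> = distr M (mat_borel n p) (\<lambda>\<omega>. \<Phi> (\<lambda>j\<in>{..<p}. col (N \<omega>) j))"
      unfolding eq using colN by (subst distr_distr[OF \<Phi>]) (auto simp: comp_def intro!: measurable_restrict)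
    also have "\<dots> = distr M (mat_borel n p) N"
    proof (rule distr_cong)
      fix \<omega> assume "\<omega> \<in> space M"
      then have "N \<omega> \<in> carrier_mat n p" using measurable_space[OF N] by simp
      then show "\<Phi> (\<lambda>j\<in>{..<p}. col (N \<omega>) j) = N \<omega>"
        by (intro eq_matI) (auto simp: \<Phi>_def)
    qed simp_all
    finally show ?thesis .
  qed
  with N show ?thesis by (simp add: rotation_invariant_def)
qed

text \<open>Applying g to the rotated data replaces \<open>H\<close> by g H, which has the same law
  by left invariance. As \<open>X\<close> is independent of \<open>H\<close>, the pairs (X, g H) and
  (X, H) have the same joint law, whatever the law of \<open>X\<close>.\<close>

lemma rotation_invariant_haar:
  assumes M: "prob_space M" and X: "X \<in> M \<rightarrow>\<^sub>M mat_borel n p"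
    and haar: "haar_prob_measure (column_rotations n p) (column_rotations_borel n p)
      (distr M (column_rotations_borel n p) H)"
    and indep: "indep_rvs M (mat_borel n p) X (column_rotations_borel n p) H"
  shows "rotation_invariant M n p (\<lambda>\<omega>. rotate_columns n p (H \<omega>) (X \<omega>))"
proof -
  let ?B = "column_rotations_borel n p" and ?A = "mat_borel n p"
  have H: "H \<in> M \<rightarrow>\<^sub>M ?B" using indep by (simp add: indep_rvs_def)
  let ?\<Psi> = "\<lambda>(A, U). rotate_columns n p U A"
  have \<Psi>: "?\<Psi> \<in> ?A \<Otimes>\<^sub>M ?B \<rightarrow>\<^sub>M ?A"
    using measurable_rotate_columns[OF measurable_fst measurable_snd] by (simp add: case_prod_beta)
  have "distr M ?A (\<lambda>\<omega>. rotate_columns n p g (rotate_columns n p (H \<omega>) (X \<omega>)))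
      = distr M ?A (\<lambda>\<omega>. rotate_columns n p (H \<omega>) (X \<omega>))"
    if g: "g \<in> carrier (column_rotations n p)" for g
  proof -
    let ?gH = "\<lambda>\<omega>. g \<otimes>\<^bsub>column_rotations n p\<^esub> H \<omega>"
    note mg = measurable_left_mult_rotation[OF g]
    have gH: "?gH \<in> M \<rightarrow>\<^sub>M ?B"
      by (rule measurable_compose[OF H mg])
    have "distr M (?A \<Otimes>\<^sub>M ?B) (\<lambda>\<omega>. (X \<omega>, ?gH \<omega>)) = distr M ?A X \<Otimes>\<^sub>M distr M ?B ?gH"
      by (rule indep_rvs_distr_pair[OF M indep_rvs_compose[OF M indep measurable_ident mg, unfolded id_def]])
    also have "distr M ?B ?gH = distr (distr M ?B H) ?B (\<lambda>h. g \<otimes>\<^bsub>column_rotations n p\<^esub> h)"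
      by (subst distr_distr[OF mg H]) (simp add: comp_def)
    also have "\<dots> = distr M ?B H"
      using haar g by (simp add: haar_prob_measure_def)
    also have "distr M ?A X \<Otimes>\<^sub>M distr M ?B H = distr M (?A \<Otimes>\<^sub>M ?B) (\<lambda>\<omega>. (X \<omega>, H \<omega>))"
      by (rule indep_rvs_distr_pair[OF M indep, symmetric])
    finally have eq: "distr M (?A \<Otimes>\<^sub>M ?B) (\<lambda>\<omega>. (X \<omega>, ?gH \<omega>)) = distr M (?A \<Otimes>\<^sub>M ?B) (\<lambda>\<omega>. (X \<omega>, H \<omega>))" .
    have "distr M ?A (\<lambda>\<omega>. rotate_columns n p g (rotate_columns n p (H \<omega>) (X \<omega>)))
        = distr M ?A (\<lambda>\<omega>. ?\<Psi> (X \<omega>, ?gH \<omega>))"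
    proof (rule distr_cong)
      fix \<omega> assume \<omega>: "\<omega> \<in> space M"
      have "H \<omega> \<in> carrier (column_rotations n p)" "X \<omega> \<in> carrier_mat n p"
        using measurable_space[OF H \<omega>] measurable_space[OF X \<omega>] by simp_all
      then show "rotate_columns n p g (rotate_columns n p (H \<omega>) (X \<omega>)) = ?\<Psi> (X \<omega>, ?gH \<omega>)"
        using rotate_columns_mult[OF g] by (simp del: mult_column_rotations carrier_column_rotations)
    qed simp_all
    also have "\<dots> = distr (distr M (?A \<Otimes>\<^sub>M ?B) (\<lambda>\<omega>. (X \<omega>, ?gH \<omega>))) ?A ?\<Psi>"
      by (subst distr_distr[OF \<Psi> measurable_Pair[OF X gH]]) (simp only: comp_def)
    also have "\<dots> = distr M ?A (\<lambda>\<omega>. ?\<Psi> (X \<omega>, H \<omega>))"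
      unfolding eq by (subst distr_distr[OF \<Psi> measurable_Pair[OF X H]]) (simp only: comp_def)
    finally show ?thesis by simp
  qed
  then show ?thesis
    using measurable_rotate_columns[OF X H] by (simp add: rotation_invariant_def)
qed

section \<open>Tail bound for the operator norm\<close>

lemma orthogonal_matsI:
  assumes U: "U \<in> carrier_mat n n"
    and "\<And>a b. a < n \<Longrightarrow> b < n \<Longrightarrow> (\<Sum>k<n. U $$ (k, a) * U $$ (k, b)) = (if a = b then 1 else 0)"
  shows "U \<in> orthogonal_mats n"
proof -
  have "transpose_mat U * U = 1\<^sub>m n"
    using assms by (intro eq_matI) (auto simp: scalar_prod_def lessThan_atLeast0)
  with U show ?thesis by (simp add: orthogonal_mats_def)
qed

lemma orthogonal_matsD:
  assumes "U \<in> orthogonal_mats n" "a < n" "b < n"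
  shows "(\<Sum>k<n. U $$ (k, a) * U $$ (k, b)) = (if a = b then 1 else 0)"
proof -
  have U: "U \<in> carrier_mat n n" "transpose_mat U * U = 1\<^sub>m n"
    using assms(1) by (auto simp: orthogonal_mats_def)
  have "(transpose_mat U * U) $$ (a, b) = (\<Sum>k<n. U $$ (k, a) * U $$ (k, b))"
    using U(1) assms(2,3) by (auto simp: scalar_prod_def lessThan_atLeast0 intro!: sum.cong)
  then show ?thesis using U(2) assms(2,3) by simp
qed

text \<open>The reflection exchanging \<open>w\<close> with the constant vector of the same norm.\<close>

lemma rotation_to_constant:
  fixes w :: "nat \<Rightarrow> real"
  assumes n: "0 < n"
  obtains U and r :: real where "U \<in> orthogonal_mats n" "r\<^sup>2 * n = (\<Sum>i<n. (w i)\<^sup>2)"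
    "\<And>i. i < n \<Longrightarrow> (\<Sum>k<n. w k * U $$ (k, i)) = r"
proof -
  define r where "r = sqrt ((\<Sum>i<n. (w i)\<^sup>2) / n)"
  have r: "r\<^sup>2 * n = (\<Sum>i<n. (w i)\<^sup>2)"
    using n by (simp add: r_def sum_nonneg)
  define d where "d i = w i - r" for i
  define s where "s = (\<Sum>i<n. (d i)\<^sup>2)"
  define c where "c = 2 / s"
  \<comment> \<open>for \<open>w\<close> already constant, \<open>s = 0\<close> and hence \<open>c = 0\<close>: the reflection becomes the identity\<close>
  have cs: "c\<^sup>2 * s = 2 * c" by (simp add: c_def power2_eq_square)
  \<comment> \<open>\<open>w\<close> and the constant vector have equal norms, so |d|^2 is twice the
    inner product of \<open>w\<close> and \<open>d\<close>. Hence \<open>c\<close> times that inner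
    product is 1 unless \<open>d\<close> vanishes.\<close>
  have dw: "c * (\<Sum>k<n. w k * d k) * d i = d i" if i: "i < n" for i
  proof (cases "s = 0")
    case True
    then have "d i = 0"
      using i unfolding s_def by (subst (asm) sum_nonneg_eq_0_iff) auto
    then show ?thesis by simp
  next
    case False
    have "s = (\<Sum>i<n. (w i)\<^sup>2) - 2 * r * (\<Sum>i<n. w i) + r\<^sup>2 * n"
      by (simp add: s_def d_def power2_diff sum.distrib sum_subtractf sum_distrib_left mult_ac)
    moreover have "(\<Sum>k<n. w k * d k) = (\<Sum>i<n. (w i)\<^sup>2) - r * (\<Sum>i<n. w i)"
      by (simp add: d_def right_diff_distrib power2_eq_square sum_subtractf sum_distrib_left mult_ac)
    ultimately have "s = 2 * (\<Sum>k<n. w k * d k)"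
      using r by simp
    then show ?thesis using False by (simp add: c_def)
  qed
  define U where "U = mat n n (\<lambda>(i, j). (if i = j then 1 else 0) - c * d i * d j)"
  have U: "U \<in> carrier_mat n n" by (simp add: U_def)
  have "U \<in> orthogonal_mats n"
  proof (rule orthogonal_matsI[OF U])
    fix a b assume ab: "a < n" "b < n"
    have "(\<Sum>k<n. U $$ (k, a) * U $$ (k, b))
        = (\<Sum>k<n. (if k = a then (if k = b then 1 else 0) else 0) - (if k = a then c * d k * d b else 0)
            - (if k = b then c * d k * d a else 0) + (c\<^sup>2 * d a * d b) * (d k)\<^sup>2)"
      using ab by (intro sum.cong) (auto simp: U_def algebra_simps power2_eq_square)
    also have "\<dots> = (if a = b then 1 else 0) - c * d a * d b - c * d b * d a + (c\<^sup>2 * d a * d b) * s"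
      using ab by (simp add: sum.distrib sum_subtractf s_def flip: sum_distrib_left)
    also have "(c\<^sup>2 * d a * d b) * s = c\<^sup>2 * s * (d a * d b)" by simp
    also have "\<dots> = 2 * c * (d a * d b)" by (simp only: cs)
    finally show "(\<Sum>k<n. U $$ (k, a) * U $$ (k, b)) = (if a = b then 1 else 0)"
      by simp
  qed
  moreover have "(\<Sum>k<n. w k * U $$ (k, i)) = r" if i: "i < n" for i
  proof -
    have "(\<Sum>k<n. w k * U $$ (k, i)) = (\<Sum>k<n. (if k = i then w k else 0) - c * d i * (w k * d k))"
      using i by (intro sum.cong) (auto simp: U_def algebra_simps)
    also have "\<dots> = w i - c * (\<Sum>k<n. w k * d k) * d i"
      using i by (simp add: sum_subtractf flip: sum_distrib_left)
    also have "\<dots> = r" by (simp add: dw[OF i]) (simp add: d_def)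
    finally show ?thesis .
  qed
  ultimately show ?thesis using that r by blast
qed

section \<open>Exponential moments of a rotation invariant random matrix\<close>

lemma nn_integral_sign_mean:
  assumes S: "finite S" and meas: "\<And>\<epsilon>. \<epsilon> \<in> signs S \<Longrightarrow> \<phi> \<epsilon> \<in> borel_measurable M"
    and nonneg: "\<And>\<epsilon> \<omega>. \<epsilon> \<in> signs S \<Longrightarrow> 0 \<le> \<phi> \<epsilon> \<omega>"
  shows "(\<integral>\<^sup>+\<omega>. ennreal (sign_mean S (\<lambda>_. 0) (\<lambda>\<epsilon>. \<phi> \<epsilon> \<omega>)) \<partial>M)
    = (\<Sum>\<epsilon>\<in>signs S. ennreal ((1 / 2) ^ card S) * (\<integral>\<^sup>+\<omega>. ennreal (\<phi> \<epsilon> \<omega>) \<partial>M))"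
proof -
  have "(\<integral>\<^sup>+\<omega>. ennreal (sign_mean S (\<lambda>_. 0) (\<lambda>\<epsilon>. \<phi> \<epsilon> \<omega>)) \<partial>M)
      = (\<integral>\<^sup>+\<omega>. (\<Sum>\<epsilon>\<in>signs S. ennreal ((1 / 2) ^ card S) * ennreal (\<phi> \<epsilon> \<omega>)) \<partial>M)"
    by (intro nn_integral_cong) (simp add: sign_mean_def nonneg ennreal_mult sum_ennreal flip: ennreal_mult)
  also have "\<dots> = (\<Sum>\<epsilon>\<in>signs S. \<integral>\<^sup>+\<omega>. ennreal ((1 / 2) ^ card S) * ennreal (\<phi> \<epsilon> \<omega>) \<partial>M)"
    using meas by (intro nn_integral_sum) simp
  also have "\<dots> = (\<Sum>\<epsilon>\<in>signs S. ennreal ((1 / 2) ^ card S) * (\<integral>\<^sup>+\<omega>. ennreal (\<phi> \<epsilon> \<omega>) \<partial>M))"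
    using meas by (intro sum.cong refl nn_integral_cmult) simp
  finally show ?thesis .
qed

lemma sum_uniform_sign_weights:
  assumes "finite S"
  shows "(\<Sum>\<epsilon>\<in>signs S. ennreal ((1 / 2) ^ card S) * c) = c"
proof -
  have "(\<Sum>\<epsilon>\<in>signs S. (1 / 2) ^ card S) = sign_mean S (\<lambda>_. 0) (\<lambda>_. 1)"
    by (simp add: sign_mean_def)
  then have "(\<Sum>\<epsilon>\<in>signs S. ennreal ((1 / 2) ^ card S)) = 1"
    using assms by (subst sum_ennreal) (simp_all only: sign_mean_const ennreal_1, simp_all)
  then show ?thesis
    by (simp only: sum_distrib_right[symmetric] mult_1_left)
qed

lemma nn_integral_sign_mean_le:
  assumes S: "finite S" and meas: "\<And>\<epsilon>. \<epsilon> \<in> signs S \<Longrightarrow> \<phi> \<epsilon> \<in> borel_measurable M"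
    and nonneg: "\<And>\<epsilon> \<omega>. \<epsilon> \<in> signs S \<Longrightarrow> 0 \<le> \<phi> \<epsilon> \<omega>"
    and le: "\<And>\<epsilon>. \<epsilon> \<in> signs S \<Longrightarrow> (\<integral>\<^sup>+\<omega>. ennreal (\<phi> \<epsilon> \<omega>) \<partial>M) \<le> c"
  shows "(\<integral>\<^sup>+\<omega>. ennreal (sign_mean S (\<lambda>_. 0) (\<lambda>\<epsilon>. \<phi> \<epsilon> \<omega>)) \<partial>M) \<le> c"
proof -
  have "(\<integral>\<^sup>+\<omega>. ennreal (sign_mean S (\<lambda>_. 0) (\<lambda>\<epsilon>. \<phi> \<epsilon> \<omega>)) \<partial>M)
      \<le> (\<Sum>\<epsilon>\<in>signs S. ennreal ((1 / 2) ^ card S) * c)"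
    by (subst nn_integral_sign_mean[OF S meas nonneg]) (assumption | intro sum_mono mult_left_mono le zero_le)+
  then show ?thesis by (simp only: sum_uniform_sign_weights[OF S])
qed

lemma bilinear_measurable:
  "(\<lambda>A. \<Sum>i<n. w i * mvec A v i) \<in> borel_measurable (mat_borel n p)"
proof -
  have "(\<lambda>A. \<Sum>i<n. w i * (\<Sum>j<p. A $$ (i, j) * v j)) \<in> borel_measurable (mat_borel n p)"
    by (intro borel_measurable_sum borel_measurable_times borel_measurable_const measurable_mat_index) auto
  then show ?thesis
    by (subst measurable_cong[where g = "\<lambda>A. \<Sum>i<n. w i * (\<Sum>j<p. A $$ (i, j) * v j)"]) (auto simp: mvec_def)
qed

lemma truncated_exp_measurable:
  assumes "0 < p"
  shows "(\<lambda>A. if two_inf_norm A \<le> b then exp (\<Sum>i<n. w i * mvec A v i) else 0) \<in> borel_measurable (mat_borel n p)"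
proof (rule measurable_If)
  show "(\<lambda>A. exp (\<Sum>i<n. w i * mvec A v i)) \<in> borel_measurable (mat_borel n p)"
    by (intro measurable_compose[OF bilinear_measurable borel_measurable_exp])
  show "{A \<in> space (mat_borel n p). two_inf_norm A \<le> b} \<in> sets (mat_borel n p)"
    using two_inf_norm_measurable[OF assms] by (intro borel_measurable_le borel_measurable_const)
qed simp

text \<open>Invariance allows \<open>Y\<close> to be replaced by \<open>Y\<close> rotated by
  \<open>g \<epsilon>\<close>, for every sign pattern, and then an average over the patterns. For a
  fixed matrix this is the exponential moment of a linear form in fair signs, controlled by the
  column norms. The truncation survives because rotations preserve column norms.\<close>

lemma nn_integral_truncated_exp_le:
  fixes w v :: "nat \<Rightarrow> real"
  assumes M: "prob_space M" and inv: "rotation_invariant M n p Y" and n: "0 < n" and p: "0 < p"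
  shows "(\<integral>\<^sup>+\<omega>. ennreal (if two_inf_norm (Y \<omega>) \<le> b then exp (\<Sum>i<n. w i * mvec (Y \<omega>) v i) else 0) \<partial>M)
    \<le> ennreal (exp (b\<^sup>2 * ((\<Sum>i<n. (w i)\<^sup>2) * (\<Sum>j<p. (v j)\<^sup>2)) / (2 * n)))"
proof -
  interpret prob_space M by fact
  have Y: "Y \<in> M \<rightarrow>\<^sub>M mat_borel n p" using inv by (simp add: rotation_invariant_def)
  obtain U and r :: real where U: "U \<in> orthogonal_mats n" and r: "r\<^sup>2 * n = (\<Sum>i<n. (w i)\<^sup>2)"
    and Uw: "\<And>i. i < n \<Longrightarrow> (\<Sum>k<n. w k * U $$ (k, i)) = r"
    using rotation_to_constant[OF n, of w] by blast
  let ?S = "{..<n} \<times> {..<p}"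
  let ?C = "exp (b\<^sup>2 * ((\<Sum>i<n. (w i)\<^sup>2) * (\<Sum>j<p. (v j)\<^sup>2)) / (2 * n))"
  define \<psi> where "\<psi> A = (if two_inf_norm A \<le> b then exp (\<Sum>i<n. w i * mvec A v i) else 0)" for A
  have \<psi>: "\<psi> \<in> borel_measurable (mat_borel n p)"
    unfolding \<psi>_def by (rule truncated_exp_measurable[OF p])
  \<comment> \<open>Column \<open>j\<close> is rotated by \<open>U\<close> times the diagonal matrix
    with the signs \<epsilon>(., j): signs first, then the reflection taking the constant direction
    to \<open>w\<close>.\<close>
  define g where "g \<epsilon> = (\<lambda>j\<in>{..<p}. mat n n (\<lambda>(k, i). U $$ (k, i) * \<epsilon> (i, j)))" for \<epsilon> :: "nat \<times> nat \<Rightarrow> real"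
  have g: "g \<epsilon> \<in> carrier (column_rotations n p)" if \<epsilon>: "\<epsilon> \<in> signs ?S" for \<epsilon>
  proof -
    have "mat n n (\<lambda>(k, i). U $$ (k, i) * \<epsilon> (i, j)) \<in> orthogonal_mats n" if j: "j < p" for j
    proof (rule orthogonal_matsI)
      fix a c assume ac: "a < n" "c < n"
      have "(\<Sum>k<n. mat n n (\<lambda>(k, i). U $$ (k, i) * \<epsilon> (i, j)) $$ (k, a) * mat n n (\<lambda>(k, i). U $$ (k, i) * \<epsilon> (i, j)) $$ (k, c))
          = \<epsilon> (a, j) * \<epsilon> (c, j) * (\<Sum>k<n. U $$ (k, a) * U $$ (k, c))"
        using ac by (simp add: sum_distrib_left mult_ac)
      also have "\<dots> = (if a = c then 1 else 0)"
        using orthogonal_matsD[OF U ac] signs_cases[OF \<epsilon>, of "(a, j)"] ac j by auto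
      finally show "(\<Sum>k<n. mat n n (\<lambda>(k, i). U $$ (k, i) * \<epsilon> (i, j)) $$ (k, a) * mat n n (\<lambda>(k, i). U $$ (k, i) * \<epsilon> (i, j)) $$ (k, c))
          = (if a = c then 1 else 0)" .
    qed simp
    then show ?thesis by (simp add: g_def)
  qed
  \<comment> \<open>U^T w is constant with value \<open>r\<close>, so every entry of
    \<open>A\<close> enters with weight r v_j and its own sign.\<close>
  have bil: "(\<Sum>k<n. w k * mvec (rotate_columns n p (g \<epsilon>) A) v k) = (\<Sum>s\<in>?S. r * v (snd s) * A $$ s * \<epsilon> s)"
    if A: "A \<in> carrier_mat n p" for A \<epsilon>
  proof -
    have "(\<Sum>k<n. w k * mvec (rotate_columns n p (g \<epsilon>) A) v k)
        = (\<Sum>k<n. \<Sum>j<p. \<Sum>i<n. w k * U $$ (k, i) * (v j * A $$ (i, j) * \<epsilon> (i, j)))"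
      unfolding mvec_def sum_distrib_left dim_rotate_columns
      using A by (intro sum.cong refl) (simp add: rotate_columns_index g_def sum_distrib_left sum_distrib_right mult_ac)
    also have "\<dots> = (\<Sum>j<p. \<Sum>k<n. \<Sum>i<n. w k * U $$ (k, i) * (v j * A $$ (i, j) * \<epsilon> (i, j)))"
      by (rule sum.swap)
    also have "\<dots> = (\<Sum>j<p. \<Sum>i<n. \<Sum>k<n. w k * U $$ (k, i) * (v j * A $$ (i, j) * \<epsilon> (i, j)))"
      by (rule sum.cong[OF refl]) (rule sum.swap)
    also have "\<dots> = (\<Sum>j<p. \<Sum>i<n. r * v j * A $$ (i, j) * \<epsilon> (i, j))"
      unfolding sum_distrib_right[symmetric] by (intro sum.cong refl) (simp add: Uw)
    also have "\<dots> = (\<Sum>i<n. \<Sum>j<p. r * v j * A $$ (i, j) * \<epsilon> (i, j))"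
      by (rule sum.swap)
    also have "\<dots> = (\<Sum>s\<in>?S. r * v (snd s) * A $$ s * \<epsilon> s)"
      by (subst sum.cartesian_product) (simp add: case_prod_beta)
    finally show ?thesis .
  qed
  have mean_le: "sign_mean ?S (\<lambda>_. 0) (\<lambda>\<epsilon>. \<psi> (rotate_columns n p (g \<epsilon>) A)) \<le> ?C" if A: "A \<in> carrier_mat n p" for A
  proof (cases "two_inf_norm A \<le> b")
    case True
    have "sign_mean ?S (\<lambda>_. 0) (\<lambda>\<epsilon>. \<psi> (rotate_columns n p (g \<epsilon>) A))
        = sign_mean ?S (\<lambda>_. 0) (\<lambda>\<epsilon>. exp (\<Sum>s\<in>?S. r * v (snd s) * A $$ s * \<epsilon> s))"
      using True by (intro sign_mean_cong) (simp only: \<psi>_def two_inf_norm_rotate_columns[OF g A] bil[OF A] if_True)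
    also have "\<dots> \<le> exp (\<Sum>s\<in>?S. (r * v (snd s) * A $$ s)\<^sup>2 / 2)"
      by (rule sign_mean_exp_linear_le) simp
    \<comment> \<open>Summing over rows first produces squared column norms, each at most b^2; the
      factor 1 / n comes from r^2 n = |w|^2.\<close>
    also have "(\<Sum>s\<in>?S. (r * v (snd s) * A $$ s)\<^sup>2 / 2) \<le> b\<^sup>2 * ((\<Sum>i<n. (w i)\<^sup>2) * (\<Sum>j<p. (v j)\<^sup>2)) / (2 * n)"
    proof -
      have "(\<Sum>s\<in>?S. (r * v (snd s) * A $$ s)\<^sup>2 / 2) = (\<Sum>i<n. \<Sum>j<p. (r * v j * A $$ (i, j))\<^sup>2 / 2)"
        by (subst sum.cartesian_product) (simp add: case_prod_beta)
      also have "\<dots> = (\<Sum>j<p. \<Sum>i<n. (r * v j * A $$ (i, j))\<^sup>2 / 2)"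
        by (rule sum.swap)
      also have "\<dots> = (\<Sum>j<p. r\<^sup>2 * (v j)\<^sup>2 / 2 * (eucl_norm (col A j))\<^sup>2)"
        using A by (intro sum.cong refl) (simp add: eucl_norm_square sum_distrib_left power_mult_distrib)
      also have "\<dots> \<le> (\<Sum>j<p. r\<^sup>2 * (v j)\<^sup>2 / 2 * b\<^sup>2)"
        using True A eucl_norm_col_le[OF A] by (intro sum_mono mult_left_mono power_mono) (auto intro: order_trans)
      also have "\<dots> = b\<^sup>2 * (r\<^sup>2 * n * (\<Sum>j<p. (v j)\<^sup>2)) / (2 * n)"
        using n by (simp add: sum_distrib_left sum_distrib_right sum_divide_distrib mult_ac)
      finally show ?thesis unfolding r .
    qed
    finally show ?thesis by simp
  next
    case False
    then have "sign_mean ?S (\<lambda>_. 0) (\<lambda>\<epsilon>. \<psi> (rotate_columns n p (g \<epsilon>) A)) = sign_mean ?S (\<lambda>_. 0) (\<lambda>_. 0)"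
      by (intro sign_mean_cong) (simp only: \<psi>_def two_inf_norm_rotate_columns[OF g A] if_False)
    then show ?thesis by simp
  qed
  have rot: "(\<lambda>\<omega>. rotate_columns n p (g \<epsilon>) (Y \<omega>)) \<in> M \<rightarrow>\<^sub>M mat_borel n p" if "\<epsilon> \<in> signs ?S" for \<epsilon>
    using g[OF that] by (intro measurable_rotate_columns[OF Y]) simp
  have same: "(\<integral>\<^sup>+\<omega>. ennreal (\<psi> (rotate_columns n p (g \<epsilon>) (Y \<omega>))) \<partial>M) = (\<integral>\<^sup>+\<omega>. ennreal (\<psi> (Y \<omega>)) \<partial>M)"
    if \<epsilon>: "\<epsilon> \<in> signs ?S" for \<epsilon>
  proof -
    have "(\<integral>\<^sup>+\<omega>. ennreal (\<psi> (rotate_columns n p (g \<epsilon>) (Y \<omega>))) \<partial>M)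
        = (\<integral>\<^sup>+A. ennreal (\<psi> A) \<partial>distr M (mat_borel n p) (\<lambda>\<omega>. rotate_columns n p (g \<epsilon>) (Y \<omega>)))"
      using \<psi> by (intro nn_integral_distr[symmetric] rot[OF \<epsilon>]) simp
    also have "distr M (mat_borel n p) (\<lambda>\<omega>. rotate_columns n p (g \<epsilon>) (Y \<omega>)) = distr M (mat_borel n p) Y"
      using inv g[OF \<epsilon>] by (simp only: rotation_invariant_def)
    also have "(\<integral>\<^sup>+A. ennreal (\<psi> A) \<partial>distr M (mat_borel n p) Y) = (\<integral>\<^sup>+\<omega>. ennreal (\<psi> (Y \<omega>)) \<partial>M)"
      using \<psi> by (intro nn_integral_distr Y) simp
    finally show ?thesis .
  qed
  \<comment> \<open>All sign patterns give the same integral, so it equals their average; exchanging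
    average and integral leaves the pointwise bound \<open>mean_le\<close>.\<close>
  have "(\<integral>\<^sup>+\<omega>. ennreal (\<psi> (Y \<omega>)) \<partial>M)
      = (\<Sum>\<epsilon>\<in>signs ?S. ennreal ((1 / 2) ^ card ?S) * (\<integral>\<^sup>+\<omega>. ennreal (\<psi> (rotate_columns n p (g \<epsilon>) (Y \<omega>))) \<partial>M))"
    by (simp only: same sum_uniform_sign_weights finite_SigmaI finite_lessThan cong: sum.cong)
  also have "\<dots> = (\<integral>\<^sup>+\<omega>. ennreal (sign_mean ?S (\<lambda>_. 0) (\<lambda>\<epsilon>. \<psi> (rotate_columns n p (g \<epsilon>) (Y \<omega>)))) \<partial>M)"
    using measurable_compose[OF rot \<psi>] by (intro nn_integral_sign_mean[symmetric]) (auto simp: \<psi>_def)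
  also have "\<dots> \<le> (\<integral>\<^sup>+\<omega>. ennreal ?C \<partial>M)"
    using measurable_space[OF Y] by (intro nn_integral_mono ennreal_leI mean_le) simp
  also have "\<dots> = ennreal ?C"
    by (simp add: emeasure_space_1)
  finally show ?thesis unfolding \<psi>_def .
qed

section \<open>Markov's inequality for the averaged exponential\<close>

lemma mvec_scale:
  "(\<Sum>i<n. c * w i * mvec A v i) = c * (\<Sum>i<n. w i * mvec A v i)"
  by (simp add: sum_distrib_left mult.assoc)

text \<open>Let \<open>Z\<close> be the average of penalised truncated exponentials over fair block
  sums. Its expectation is at most 1 by the moment bound, and it is at least exp (2 q \<gamma>) on
  the bad event by the variational bound at the top singular vectors. Markov's inequality
  concludes.\<close>

lemma op_norm_tail:
  fixes n p :: nat and b \<gamma> :: real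
  assumes M: "prob_space M" and inv: "rotation_invariant M n p Y" and n: "0 < n" and p: "0 < p" and b: "0 \<le> b" and \<gamma>: "0 \<le> \<gamma>"
  shows "measure M {\<omega> \<in> space M. two_inf_norm (Y \<omega>) \<le> b \<and>
      (2 + \<gamma>) * (b * (sqrt n + sqrt p) / sqrt n) < op_norm (Y \<omega>)} \<le> exp (- (2 * sqrt (n * p) * \<gamma>))"
    (is "measure M ?Bad \<le> _")
proof (cases "b = 0")
  \<comment> \<open>The parameter \<theta> of the main case divides by \<open>b\<close>. For b = 0
    the column bound forces a zero matrix, whose operator norm does not exceed the threshold
    0.\<close>
  case True
  interpret prob_space M by fact
  have Y: "Y \<in> M \<rightarrow>\<^sub>M mat_borel n p" using inv by (simp add: rotation_invariant_def)
  have "op_norm A = 0" if A: "A \<in> carrier_mat n p" and le: "two_inf_norm A \<le> 0" for A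
  proof (rule op_norm_zero_columns[OF A p])
    fix i j assume ij: "i < n" "j < p"
    have "eucl_norm (col A j) = 0"
      using eucl_norm_col_le[OF A ij(2)] le eucl_norm_nonneg[of "col A j"] by linarith
    then have "(\<Sum>i<n. (vec_index (col A j) i)\<^sup>2) = 0"
      using eucl_norm_square[of "col A j"] A by simp
    then show "A $$ (i, j) = 0"
      using A ij by (subst (asm) sum_nonneg_eq_0_iff) auto
  qed
  then have "?Bad = {}"
    using True measurable_space[OF Y] by fastforce
  then show ?thesis by (simp only: measure_empty) simp
next
  case False
  interpret prob_space M by fact
  have Y: "Y \<in> M \<rightarrow>\<^sub>M mat_borel n p" using inv by (simp add: rotation_invariant_def)
  have bpos: "0 < b" using False b by simp
  \<comment> \<open>This value minimises q (1 + n / q) (1 + p / q) = q + n + p + n p / q; the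
    minimum is (sqrt n + sqrt p)^2 = D^2.\<close>
  define q where "q = sqrt (n * p)"
  define D where "D = sqrt n + sqrt p"
  \<comment> \<open>Chosen so that the mean penalty \<kappa> D^2 / q and the entropy cost both equal
    2 q, while \<theta> b D / sqrt n is also 2 q. The exponent at the threshold is then 2 q (2 +
    \<gamma>) - 4 q = 2 q \<gamma>.\<close>
  define \<theta> where "\<theta> = 2 * q * sqrt n / (b * D)"
  \<comment> \<open>The coefficient in the moment bound for the vector scaled by \<theta>; as a
    penalty it cancels that bound.\<close>
  define \<kappa> where "\<kappa> = \<theta>\<^sup>2 * b\<^sup>2 / (2 * n)"
  \<comment> \<open>With L \<ge> q the choice of \<open>h\<close> yields both h^2 L q = 1 and h L =
    sqrt (L / q) \<ge> 1.\<close>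
  define L where "L = nat \<lceil>q\<rceil>"
  define h where "h = 1 / sqrt (q * L)"
  have q: "0 < q" using n p by (simp add: q_def)
  have D: "0 < D" using n p by (simp add: D_def add_pos_pos)
  have L: "q \<le> L" "0 < real L" using q by (auto simp: L_def)
  have h: "0 < h" "1 \<le> h * L" "h\<^sup>2 * L * q = 1"
  proof -
    show "0 < h" using q L by (simp add: h_def)
    show "h\<^sup>2 * L * q = 1" using q L by (simp add: h_def power_divide)
    have "sqrt (q * L) \<le> sqrt (L * L)" using L q by (intro real_sqrt_le_mono mult_right_mono) auto
    then show "1 \<le> h * L" using q L by (simp add: h_def)
  qed
  have \<theta>: "0 < \<theta>" using q n bpos D by (simp add: \<theta>_def)
  have \<kappa>: "0 \<le> \<kappa>" by (simp add: \<kappa>_def)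
  have D2: "(1 + n / q) * (1 + p / q) = D\<^sup>2 / q"
  proof -
    have "D\<^sup>2 = real n + real p + 2 * q"
      by (simp add: D_def q_def power2_sum real_sqrt_mult)
    moreover have "q * q = real n * real p" by (simp add: q_def)
    moreover have "(q + n) * (q + p) = q * q + q * (real n + real p) + real n * real p"
      by (simp add: algebra_simps)
    ultimately have "(q + n) * (q + p) = q * D\<^sup>2"
      by (simp add: algebra_simps)
    moreover have "(1 + n / q) * (1 + p / q) = (q + n) * (q + p) / (q * q)"
    proof -
      have "1 + x / q = (q + x) / q" for x using q by (simp add: field_simps)
      then show ?thesis by simp
    qed
    ultimately show ?thesis using q by simp
  qed
  have \<kappa>D: "\<kappa> * (D\<^sup>2 / q) = 2 * q"
  proof -
    have "\<theta>\<^sup>2 = 4 * q\<^sup>2 * n / (b\<^sup>2 * D\<^sup>2)"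
      by (simp add: \<theta>_def power_divide power_mult_distrib)
    then have "\<kappa> * (D\<^sup>2 / q) = 4 * q\<^sup>2 * n / (b\<^sup>2 * D\<^sup>2) * b\<^sup>2 / (2 * n) * (D\<^sup>2 / q)"
      by (simp add: \<kappa>_def)
    also have "\<dots> = 2 * q"
      using bpos D q n by (simp add: field_simps power2_eq_square)
    finally show ?thesis .
  qed
  let ?S = "{..<n} \<times> {..<L}" and ?T = "{..<p} \<times> {..<L}"
  define w where "w \<epsilon> i = \<theta> * block_sum h L \<epsilon> i" for \<epsilon> i
  define P where "P \<epsilon> \<delta> = (\<Sum>i<n. (block_sum h L \<epsilon> i)\<^sup>2) * (\<Sum>j<p. (block_sum h L \<delta> j)\<^sup>2)" for \<epsilon> \<delta>
  define \<psi> where "\<psi> \<epsilon> \<delta> A = (if two_inf_norm A \<le> b then exp (\<Sum>i<n. w \<epsilon> i * mvec A (block_sum h L \<delta>) i) else 0) * exp (- \<kappa> * P \<epsilon> \<delta>)" for \<epsilon> \<delta> A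
  define Z where "Z A = sign_mean ?S (\<lambda>_. 0) (\<lambda>\<epsilon>. sign_mean ?T (\<lambda>_. 0) (\<lambda>\<delta>. \<psi> \<epsilon> \<delta> A))" for A
  have \<psi>_meas: "(\<lambda>\<omega>. \<psi> \<epsilon> \<delta> (Y \<omega>)) \<in> borel_measurable M" for \<epsilon> \<delta>
    unfolding \<psi>_def
    by (rule borel_measurable_times[OF measurable_compose[OF Y truncated_exp_measurable[OF p]] borel_measurable_const])
  have \<psi>_nonneg: "0 \<le> \<psi> \<epsilon> \<delta> A" for \<epsilon> \<delta> A by (simp add: \<psi>_def)
  \<comment> \<open>The penalty depends on the signs alone, so it leaves the integral and cancels
    the moment bound exactly.\<close>
  have \<psi>_le: "(\<integral>\<^sup>+\<omega>. ennreal (\<psi> \<epsilon> \<delta> (Y \<omega>)) \<partial>M) \<le> 1" for \<epsilon> \<delta>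
  proof -
    have "(\<integral>\<^sup>+\<omega>. ennreal (\<psi> \<epsilon> \<delta> (Y \<omega>)) \<partial>M)
        = (\<integral>\<^sup>+\<omega>. ennreal (if two_inf_norm (Y \<omega>) \<le> b then exp (\<Sum>i<n. w \<epsilon> i * mvec (Y \<omega>) (block_sum h L \<delta>) i) else 0)
            * ennreal (exp (- \<kappa> * P \<epsilon> \<delta>)) \<partial>M)"
      unfolding \<psi>_def by (subst ennreal_mult) auto
    also have "\<dots> = (\<integral>\<^sup>+\<omega>. ennreal (if two_inf_norm (Y \<omega>) \<le> b then exp (\<Sum>i<n. w \<epsilon> i * mvec (Y \<omega>) (block_sum h L \<delta>) i) else 0) \<partial>M)
            * ennreal (exp (- \<kappa> * P \<epsilon> \<delta>))"
      by (intro nn_integral_multc measurable_compose[OF measurable_compose[OF Y truncated_exp_measurable[OF p]] measurable_ennreal])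
    also have "\<dots> \<le> ennreal (exp (b\<^sup>2 * ((\<Sum>i<n. (w \<epsilon> i)\<^sup>2) * (\<Sum>j<p. (block_sum h L \<delta> j)\<^sup>2)) / (2 * n)))
            * ennreal (exp (- \<kappa> * P \<epsilon> \<delta>))"
      by (intro mult_right_mono nn_integral_truncated_exp_le[OF M inv n p]) simp
    also have "b\<^sup>2 * ((\<Sum>i<n. (w \<epsilon> i)\<^sup>2) * (\<Sum>j<p. (block_sum h L \<delta> j)\<^sup>2)) / (2 * n) = \<kappa> * P \<epsilon> \<delta>"
      by (simp add: w_def P_def \<kappa>_def power_mult_distrib flip: sum_distrib_left)
    also have "ennreal (exp (\<kappa> * P \<epsilon> \<delta>)) * ennreal (exp (- \<kappa> * P \<epsilon> \<delta>)) = 1"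
      by (simp flip: ennreal_mult exp_add)
    finally show ?thesis .
  qed
  have inner_meas: "(\<lambda>\<omega>. sign_mean ?T (\<lambda>_. 0) (\<lambda>\<delta>. \<psi> \<epsilon> \<delta> (Y \<omega>))) \<in> borel_measurable M" for \<epsilon>
    unfolding sign_mean_def by (intro borel_measurable_sum borel_measurable_times borel_measurable_const \<psi>_meas)
  have inner_nonneg: "0 \<le> sign_mean ?T (\<lambda>_. 0) (\<lambda>\<delta>. \<psi> \<epsilon> \<delta> A)" for \<epsilon> A
    unfolding sign_mean_def by (intro sum_nonneg mult_nonneg_nonneg prod_nonneg \<psi>_nonneg) simp
  have Z_le: "(\<integral>\<^sup>+\<omega>. ennreal (Z (Y \<omega>)) \<partial>M) \<le> 1"
    unfolding Z_def
    by (intro nn_integral_sign_mean_le[OF _ inner_meas inner_nonneg] nn_integral_sign_mean_le[OF _ \<psi>_meas \<psi>_nonneg] \<psi>_le)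
       auto
  have Z_nonneg: "0 \<le> Z A" for A
    unfolding Z_def sign_mean_def[of ?S] by (intro sum_nonneg mult_nonneg_nonneg prod_nonneg inner_nonneg) simp
  \<comment> \<open>The column bound switches the truncation off, and \<open>Z A\<close> becomes the
    double sign average of the variational bound.\<close>
  have Z_ge: "exp (2 * q * \<gamma>) \<le> Z A"
    if A: "A \<in> carrier_mat n p" and le: "two_inf_norm A \<le> b" and gt: "(2 + \<gamma>) * (b * D / sqrt n) < op_norm A"
      and pos: "0 < op_norm A" for A
  proof -
    obtain u v where uv: "(\<Sum>i<n. (u i)\<^sup>2) = 1" "(\<Sum>j<p. (v j)\<^sup>2) = 1" "(\<Sum>i<n. u i * mvec A v i) = op_norm A"
      using op_norm_dual[OF A p pos] by blast
    have "\<theta> * ((2 + \<gamma>) * (b * D / sqrt n)) = 2 * q * (2 + \<gamma>)"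
      using bpos D n by (simp add: \<theta>_def)
    then have "2 * q * (2 + \<gamma>) \<le> \<theta> * op_norm A"
      using mult_left_mono[OF less_imp_le[OF gt] less_imp_le[OF \<theta>]] by simp
    then have "2 * q * \<gamma> \<le> \<theta> * op_norm A - \<kappa> * ((1 + n / q) * (1 + p / q)) - 2 * q"
      unfolding D2 \<kappa>D by (simp add: algebra_simps)
    then have "exp (2 * q * \<gamma>) \<le> exp (\<theta> * op_norm A - \<kappa> * ((1 + n / q) * (1 + p / q)) - 2 * q)"
      by simp
    also have "\<dots> \<le> sign_mean ?S (\<lambda>_. 0) (\<lambda>\<epsilon>. sign_mean ?T (\<lambda>_. 0) (\<lambda>\<delta>.
        exp (\<theta> * (\<Sum>i<n. block_sum h L \<epsilon> i * mvec A (block_sum h L \<delta>) i)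
          - \<kappa> * ((\<Sum>i<n. (block_sum h L \<epsilon> i)\<^sup>2) * (\<Sum>j<p. (block_sum h L \<delta> j)\<^sup>2)))))"
      unfolding uv(3)[symmetric] by (rule sign_mean_exp_bilinear_ge[OF A uv(1,2) h q \<kappa>])
    also have "\<dots> = Z A"
      unfolding Z_def \<psi>_def P_def w_def mvec_scale if_P[OF le] by (simp flip: exp_add)
    finally show ?thesis .
  qed
  \<comment> \<open>On the bad event this makes the operator norm positive, as the choice of
    singular vectors requires.\<close>
  have threshold: "0 \<le> (2 + \<gamma>) * (b * D / sqrt n)"
    using \<gamma> bpos D by simp
  have Bad: "?Bad \<in> sets M"
    by (intro sets.sets_Collect_conj borel_measurable_le borel_measurable_less borel_measurable_const
        measurable_compose[OF Y two_inf_norm_measurable[OF p]] measurable_compose[OF Y op_norm_measurable[OF p]])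
  have "ennreal (exp (2 * q * \<gamma>)) * emeasure M ?Bad = (\<integral>\<^sup>+\<omega>. ennreal (exp (2 * q * \<gamma>)) * indicator ?Bad \<omega> \<partial>M)"
    using Bad by (simp add: nn_integral_cmult_indicator)
  also have "\<dots> \<le> (\<integral>\<^sup>+\<omega>. ennreal (Z (Y \<omega>)) \<partial>M)"
  proof (intro nn_integral_mono)
    fix \<omega> assume \<omega>: "\<omega> \<in> space M"
    have A: "Y \<omega> \<in> carrier_mat n p" using measurable_space[OF Y \<omega>] by simp
    show "ennreal (exp (2 * q * \<gamma>)) * indicator ?Bad \<omega> \<le> ennreal (Z (Y \<omega>))"
    proof (cases "\<omega> \<in> ?Bad")
      case True
      then have "two_inf_norm (Y \<omega>) \<le> b" "(2 + \<gamma>) * (b * D / sqrt n) < op_norm (Y \<omega>)"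
        by (simp_all add: D_def)
      with Z_ge[OF A] threshold True show ?thesis
        by (simp add: ennreal_leI)
    qed simp
  qed
  also have "\<dots> \<le> 1" by (rule Z_le)
  finally have "ennreal (exp (2 * q * \<gamma>)) * ennreal (prob ?Bad) \<le> ennreal 1"
    by (simp only: emeasure_eq_measure ennreal_1)
  then have "exp (2 * q * \<gamma>) * prob ?Bad \<le> 1"
    by (simp only: ennreal_mult[symmetric] exp_ge_zero measure_nonneg ennreal_le_iff zero_le_one)
  then have "prob ?Bad \<le> 1 / exp (2 * q * \<gamma>)"
    by (simp only: pos_le_divide_eq exp_gt_zero mult.commute)
  then show ?thesis
    unfolding q_def by (simp only: exp_minus inverse_eq_divide)
qed

section \<open>The randomization test\<close>

text \<open>The entries below \<open>c\<close> form an initial segment of a sorted list. Indices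
  start at 0, hence the strict inequality on the right.\<close>

lemma sorted_nth_less_iff:
  fixes c :: "'a :: linorder"
  assumes "sorted ys" "i < length ys"
  shows "ys ! i < c \<longleftrightarrow> i < length (filter (\<lambda>x. x < c) ys)"
proof
  assume less: "ys ! i < c"
  have "x < c" if "x \<in> set (take (Suc i) ys)" for x
  proof -
    obtain j where "j \<le> i" "x = ys ! j"
      using \<open>x \<in> set (take (Suc i) ys)\<close> assms(2) by (auto simp: in_set_conv_nth less_Suc_eq_le)
    then show ?thesis
      using less sorted_nth_mono[OF assms(1), of j i] assms(2) by auto
  qed
  then have "filter (\<lambda>x. x < c) (take (Suc i) ys) = take (Suc i) ys"
    by (simp add: filter_id_conv)
  then have "length (filter (\<lambda>x. x < c) (take (Suc i) ys @ drop (Suc i) ys)) \<ge> Suc i"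
    using assms(2) by (simp only: filter_append) simp
  then show "i < length (filter (\<lambda>x. x < c) ys)" by simp
next
  assume less: "i < length (filter (\<lambda>x. x < c) ys)"
  show "ys ! i < c"
  proof (rule ccontr)
    assume "\<not> ys ! i < c"
    then have "c \<le> ys ! i" by simp
    have "\<not> x < c" if x: "x \<in> set (drop i ys)" for x
    proof -
      obtain j where j: "j < length (drop i ys)" "x = drop i ys ! j"
        using x by (metis in_set_conv_nth)
      then have "ys ! i \<le> x"
        using sorted_nth_mono[OF assms(1), of i "i + j"] assms(2) by simp
      with \<open>c \<le> ys ! i\<close> show ?thesis by (simp add: not_less order_trans)
    qed
    then have "filter (\<lambda>x. x < c) (drop i ys) = []"
      by (simp add: filter_empty_conv)
    then have "filter (\<lambda>x. x < c) (take i ys @ drop i ys) = filter (\<lambda>x. x < c) (take i ys)"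
      by (simp only: filter_append append_Nil2)
    then show False
      using less length_filter_le[of "\<lambda>x. x < c" "take i ys"] by simp
  qed
qed

text \<open>The observed value is not strictly below itself, so only rotated values count: the k-th
  smallest value lies below it exactly if at least k of them do. For k = 0 the order statistic is
  minus infinity and both sides hold.\<close>

lemma randomization_rejects_iff:
  assumes k: "nat \<lceil>(1 - \<alpha>) * (real K + 1)\<rceil> \<le> K"
  shows "randomization_rejects f act \<alpha> K x g \<longleftrightarrow>
    nat \<lceil>(1 - \<alpha>) * (real K + 1)\<rceil> \<le> card {i \<in> {1..K}. f (act (g i) x) < f x}"
proof -
  define k where "k = nat \<lceil>(1 - \<alpha>) * (real K + 1)\<rceil>"
  define xs where "xs = f x # map (\<lambda>i. f (act (g i) x)) [1..<K + 1]"
  have "length (filter (\<lambda>y. y < f x) (sort xs)) = length (filter (\<lambda>y. y < f x) xs)"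
    by (metis filter_sort length_sort)
  also have "\<dots> = length (filter (\<lambda>i. f (act (g i) x) < f x) [1..<K + 1])"
    by (simp add: xs_def filter_map comp_def)
  also have "\<dots> = card {i \<in> {1..K}. f (act (g i) x) < f x}"
    by (subst distinct_card[symmetric]) (auto intro!: arg_cong[of _ _ card])
  finally have len: "length (filter (\<lambda>y. y < f x) (sort xs)) = card {i \<in> {1..K}. f (act (g i) x) < f x}" .
  have rej: "randomization_rejects f act \<alpha> K x g \<longleftrightarrow> k = 0 \<or> sort xs ! (k - 1) < f x"
    unfolding randomization_rejects_def order_statistic_def k_def[symmetric] xs_def[symmetric] by simp
  show ?thesis
  proof (cases "k = 0")
    case False
    then have "k - 1 < length (sort xs)" using k[folded k_def] by (simp add: xs_def)
    then have "sort xs ! (k - 1) < f x \<longleftrightarrow> k - 1 < card {i \<in> {1..K}. f (act (g i) x) < f x}"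
      using sorted_nth_less_iff[of "sort xs" "k - 1" "f x"] len by simp
    then show ?thesis using rej False by (auto simp flip: k_def)
  qed (use rej in \<open>simp flip: k_def\<close>)
qed

text \<open>The level condition says (1 - \<alpha>) (K + 1) \<le> K, so the test rejects as soon as
  all \<open>K\<close> rotated values lie below the observed one.\<close>

lemma quantile_index_le:
  assumes "1 / (real K + 1) \<le> \<alpha>"
  shows "nat \<lceil>(1 - \<alpha>) * (real K + 1)\<rceil> \<le> K"
proof -
  have "1 \<le> \<alpha> * (real K + 1)" using assms by (simp add: pos_divide_le_eq)
  then have "(1 - \<alpha>) * (real K + 1) \<le> of_int (int K)" by (simp add: left_diff_distrib)
  then have "\<lceil>(1 - \<alpha>) * (real K + 1)\<rceil> \<le> int K" by (rule ceiling_le)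
  then show ?thesis by (simp only: nat_le_iff)
qed

lemma card_less_measurable:
  fixes F :: "nat \<Rightarrow> 'w \<Rightarrow> real"
  assumes "F0 \<in> borel_measurable M" "\<And>i. i \<in> I \<Longrightarrow> F i \<in> borel_measurable M" and I: "finite I"
  shows "{\<omega> \<in> space M. k \<le> card {i \<in> I. F i \<omega> < F0 \<omega>}} \<in> sets M"
proof -
  have "(\<lambda>\<omega>. if F i \<omega> < F0 \<omega> then 1 else 0 :: real) \<in> borel_measurable M" if "i \<in> I" for i
    using assms(1) assms(2)[OF that] by (intro measurable_If borel_measurable_const borel_measurable_less)
  then have "(\<lambda>\<omega>. \<Sum>i\<in>I. if F i \<omega> < F0 \<omega> then 1 else 0 :: real) \<in> borel_measurable M"
    by (rule borel_measurable_sum)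
  then have "{\<omega> \<in> space M. real k \<le> (\<Sum>i\<in>I. if F i \<omega> < F0 \<omega> then 1 else 0)} \<in> sets M"
    by (intro borel_measurable_le borel_measurable_const)
  moreover have "(\<Sum>i\<in>I. if F i \<omega> < F0 \<omega> then 1 else 0 :: real) = real (card {i \<in> I. F i \<omega> < F0 \<omega>})" for \<omega>
    using I by (simp flip: sum.inter_filter)
  ultimately show ?thesis by simp
qed

section \<open>Lower bound for the rejection probability at a fixed size\<close>

text \<open>A union bound over K + 1 bad events: the noise or one of the \<open>K\<close> rotated
  data matrices has an operator norm too large for its column norms. Outside them, and with the
  noise columns bounded by \<open>t\<close>, every rotated statistic is smaller than the observed
  one. The margin \<gamma> above 2 is the one in the tail bound.\<close>

lemma rejection_probability_ge:
  fixes n p :: nat and t \<gamma> :: real and G :: "nat \<Rightarrow> 'w \<Rightarrow> nat \<Rightarrow> real mat"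
  assumes M: "prob_space M" and n: "0 < n" and p: "0 < p" and s: "s \<in> carrier_mat n p"
    and level: "1 / (real K + 1) \<le> \<alpha>"
    and N: "N \<in> M \<rightarrow>\<^sub>M mat_borel n p"
    and columns_indep: "prob_space.indep_vars M (\<lambda>_. vec_borel n) (\<lambda>j \<omega>. col (N \<omega>) j) {..<p}"
    and columns_spherical: "\<And>j. j < p \<Longrightarrow> spherical M n (\<lambda>\<omega>. col (N \<omega>) j)"
    and haar: "\<And>k. k \<in> {1..K} \<Longrightarrow> haar_prob_measure (column_rotations n p) (column_rotations_borel n p)
        (distr M (column_rotations_borel n p) (G k))"
    and indep: "indep_rvs M (mat_borel n p) N
        (\<Pi>\<^sub>M k\<in>{1..K}. column_rotations_borel n p) (\<lambda>\<omega>. \<lambda>k\<in>{1..K}. G k \<omega>)"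
    and pos: "0 < measure M {\<omega> \<in> space M. two_inf_norm (N \<omega>) \<le> t}"
    and \<gamma>: "0 \<le> \<gamma>"
    and signal: "2 + \<gamma> < (op_norm s / (sqrt n + sqrt p)) / ((two_inf_norm s + 2 * t) / sqrt n)"
  shows "measure M {\<omega> \<in> space M. two_inf_norm (N \<omega>) \<le> t} - (real K + 1) * exp (- (2 * sqrt (n * p) * \<gamma>))
    \<le> measure M {\<omega> \<in> space M.
        randomization_rejects op_norm (rotate_columns n p) \<alpha> K (s + N \<omega>) (\<lambda>k. G k \<omega>)}"
proof -
  interpret prob_space M by fact
  define D where "D = sqrt n + sqrt p"
  define a where "a = two_inf_norm s"
  define e where "e = exp (- (2 * sqrt (n * p) * \<gamma>))"
  define thr where "thr b = (2 + \<gamma>) * (b * D / sqrt n)" for b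
  define E where "E = {\<omega> \<in> space M. two_inf_norm (N \<omega>) \<le> t}"
  define Y where "Y k \<omega> = rotate_columns n p (G k \<omega>) (s + N \<omega>)" for k \<omega>
  define BadN where "BadN = {\<omega> \<in> space M. two_inf_norm (N \<omega>) \<le> t \<and> thr t < op_norm (N \<omega>)}"
  define Bad where "Bad k = {\<omega> \<in> space M. two_inf_norm (Y k \<omega>) \<le> a + t \<and> thr (a + t) < op_norm (Y k \<omega>)}" for k
  define R where "R = {\<omega> \<in> space M.
        randomization_rejects op_norm (rotate_columns n p) \<alpha> K (s + N \<omega>) (\<lambda>k. G k \<omega>)}"
  have D: "0 < D" using n p by (simp add: D_def add_pos_pos)
  have a: "0 \<le> a" using two_inf_norm_nonneg[OF s p] by (simp add: a_def)
  have Nc: "N \<omega> \<in> carrier_mat n p" if "\<omega> \<in> space M" for \<omega>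
    using measurable_space[OF N that] by simp
  \<comment> \<open>An event of positive probability is nonempty, so \<open>t\<close> bounds the
    nonnegative norm of some noise matrix.\<close>
  have t: "0 \<le> t"
  proof -
    have "E \<noteq> {}" using pos unfolding E_def[symmetric] by auto
    then obtain \<omega> where "\<omega> \<in> space M" "two_inf_norm (N \<omega>) \<le> t" by (auto simp: E_def)
    then show ?thesis using two_inf_norm_nonneg[OF Nc p] by fastforce
  qed
  have signal': "2 + \<gamma> < (op_norm s / D) / ((a + 2 * t) / sqrt n)"
    using signal by (simp add: D_def a_def)
  \<comment> \<open>If the denominator in the signal condition were 0, the quotient would be 0 by
    convention and could not exceed 2 + \<gamma>.\<close>
  have T: "0 < a + 2 * t"
  proof (rule ccontr)
    assume "\<not> 0 < a + 2 * t"
    then have "a + 2 * t = 0" using a t by simp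
    with signal' \<gamma> show False by simp
  qed
  \<comment> \<open>\<open>thr\<close> is linear, so the thresholds for the rotated data (column
    bound a + t) and for the noise (column bound \<open>t\<close>) add up to the one for a + 2 t.
    This is where the term 2 t in the signal condition comes from.\<close>
  have gap: "thr (a + t) + thr t < op_norm s"
  proof -
    have "(2 + \<gamma>) * ((a + 2 * t) / sqrt n) < op_norm s / D"
      using signal' T n by (subst (asm) pos_less_divide_eq) auto
    then have "(2 + \<gamma>) * ((a + 2 * t) / sqrt n) * D < op_norm s"
      using D by (subst (asm) pos_less_divide_eq) auto
    moreover have "thr (a + t) + thr t = (2 + \<gamma>) * ((a + 2 * t) / sqrt n) * D"
      by (simp add: thr_def add_divide_distrib algebra_simps)
    ultimately show ?thesis by simp
  qed
  have X: "(\<lambda>\<omega>. s + N \<omega>) \<in> M \<rightarrow>\<^sub>M mat_borel n p"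
    by (rule measurable_mat_add[OF s N])
  have indep_k: "indep_rvs M (mat_borel n p) N (column_rotations_borel n p) (G k)" if k: "k \<in> {1..K}" for k
    using indep_rvs_compose[OF M indep measurable_ident measurable_component_singleton[OF k]] k by (simp add: id_def)
  have G: "G k \<in> M \<rightarrow>\<^sub>M column_rotations_borel n p" if "k \<in> {1..K}" for k
    using indep_k[OF that] by (simp add: indep_rvs_def)
  have invN: "rotation_invariant M n p N"
    by (rule rotation_invariant_spherical_columns[OF M N p columns_indep columns_spherical])
  have invY: "rotation_invariant M n p (Y k)" if k: "k \<in> {1..K}" for k
  proof -
    have "indep_rvs M (mat_borel n p) (\<lambda>\<omega>. s + N \<omega>) (column_rotations_borel n p) (G k)"
      by (rule indep_rvs_compose[OF M indep_k[OF k] measurable_mat_add[OF s measurable_ident, unfolded id_def]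
            measurable_ident, unfolded id_def])
    then show ?thesis
      unfolding Y_def by (rule rotation_invariant_haar[OF M X haar[OF k]])
  qed
  have Y: "Y k \<in> M \<rightarrow>\<^sub>M mat_borel n p" if "k \<in> {1..K}" for k
    using invY[OF that] by (simp add: rotation_invariant_def)
  have BadN_le: "measure M BadN \<le> e"
    unfolding BadN_def thr_def D_def e_def by (rule op_norm_tail[OF M invN n p t \<gamma>])
  have Bad_le: "measure M (Bad k) \<le> e" if "k \<in> {1..K}" for k
    unfolding Bad_def thr_def D_def e_def using a t by (intro op_norm_tail[OF M invY[OF that] n p _ \<gamma>]) simp
  note norms = measurable_compose[OF _ two_inf_norm_measurable[OF p]] measurable_compose[OF _ op_norm_measurable[OF p]]
  have BadN_sets: "BadN \<in> sets M"
    unfolding BadN_def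
    by (intro sets.sets_Collect_conj borel_measurable_le borel_measurable_less borel_measurable_const norms[OF N])
  have Bad_sets: "Bad k \<in> sets M" if "k \<in> {1..K}" for k
    unfolding Bad_def
    by (intro sets.sets_Collect_conj borel_measurable_le borel_measurable_less borel_measurable_const norms[OF Y[OF that]])
  note iff = randomization_rejects_iff[OF quantile_index_le[OF level], of op_norm]
  have R_sets: "R \<in> sets M"
    unfolding R_def iff
    by (intro card_less_measurable norms(2)[OF X] norms(2)[OF Y[unfolded Y_def]]) auto
  \<comment> \<open>Off the bad events, the rotated norms are at most thr (a + t), which is less
    than op_norm s - thr t and hence less than the observed norm.\<close>
  have sub: "E \<subseteq> R \<union> BadN \<union> (\<Union>k\<in>{1..K}. Bad k)"
  proof (rule subsetI, rule ccontr)
    fix \<omega> assume E: "\<omega> \<in> E" and not: "\<omega> \<notin> R \<union> BadN \<union> (\<Union>k\<in>{1..K}. Bad k)"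
    have \<omega>: "\<omega> \<in> space M" and le: "two_inf_norm (N \<omega>) \<le> t" using E by (simp_all add: E_def)
    have opN: "op_norm (N \<omega>) \<le> thr t" using not \<omega> le by (auto simp: BadN_def not_less)
    have Xc: "s + N \<omega> \<in> carrier_mat n p" using Nc[OF \<omega>] s by simp
    have X_le: "two_inf_norm (s + N \<omega>) \<le> a + t"
      using two_inf_norm_add_le[OF s Nc[OF \<omega>] p] le by (simp add: a_def)
    have "op_norm (Y k \<omega>) < op_norm (s + N \<omega>)" if k: "k \<in> {1..K}" for k
    proof -
      have "G k \<omega> \<in> carrier (column_rotations n p)"
        using measurable_space[OF G[OF k] \<omega>] by simp
      then have "two_inf_norm (Y k \<omega>) \<le> a + t"
        using X_le unfolding Y_def by (simp only: two_inf_norm_rotate_columns[OF _ Xc])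
      then have "op_norm (Y k \<omega>) \<le> thr (a + t)"
        using not \<omega> k by (auto simp: Bad_def not_less)
      also have "\<dots> < op_norm s - op_norm (N \<omega>)" using gap opN by linarith
      also have "\<dots> \<le> op_norm (s + N \<omega>)" using op_norm_diff_le[OF s Nc[OF \<omega>] p] by simp
      finally show ?thesis .
    qed
    then have "{i \<in> {1..K}. op_norm (rotate_columns n p (G i \<omega>) (s + N \<omega>)) < op_norm (s + N \<omega>)} = {1..K}"
      by (auto simp: Y_def)
    then have "\<omega> \<in> R"
      unfolding R_def iff using \<omega> quantile_index_le[OF level] by simp
    with not show False by simp
  qed
  have "measure M E \<le> measure M (R \<union> BadN \<union> (\<Union>k\<in>{1..K}. Bad k))"
    using sub R_sets BadN_sets Bad_sets by (intro finite_measure_mono sets.Un sets.finite_UN) auto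
  also have "\<dots> \<le> measure M R + measure M BadN + measure M (\<Union>k\<in>{1..K}. Bad k)"
    using measure_Un_le[of "R \<union> BadN" M "\<Union>k\<in>{1..K}. Bad k"] measure_Un_le[OF R_sets BadN_sets]
      R_sets BadN_sets Bad_sets by (fastforce intro: sets.Un sets.finite_UN)
  also have "measure M (\<Union>k\<in>{1..K}. Bad k) \<le> (\<Sum>k\<in>{1..K}. measure M (Bad k))"
    using Bad_sets by (intro measure_UNION_le) auto
  also have "\<dots> \<le> (\<Sum>k\<in>{1..K}. e)" by (intro sum_mono Bad_le)
  also have "(\<Sum>k\<in>{1..K}. e) = real K * e" by simp
  finally have "measure M E - (real K + 1) * e \<le> measure M R"
    using BadN_le by (simp add: algebra_simps)
  then show ?thesis by (simp only: E_def e_def R_def)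
qed

section \<open>Passage to the limit\<close>

lemma exp_neg_sqrt_tendsto_0:
  fixes n p :: "nat \<Rightarrow> nat"
  assumes "filterlim n at_top sequentially" "filterlim p at_top sequentially" and c: "0 < c"
  shows "(\<lambda>m. exp (- (2 * sqrt (n m * p m) * c))) \<longlonglongrightarrow> 0"
proof -
  have "filterlim (\<lambda>m. real (n m)) at_top sequentially" "filterlim (\<lambda>m. real (p m)) at_top sequentially"
    using assms(1,2) filterlim_compose[OF filterlim_real_sequentially] by blast+
  then have "filterlim (\<lambda>m. real (n m) * real (p m)) at_top sequentially"
    by (rule filterlim_at_top_mult_at_top)
  then have "filterlim (\<lambda>m. sqrt (n m * p m)) at_top sequentially"
    using filterlim_compose[OF sqrt_at_top] by simp
  then have "filterlim (\<lambda>m. (2 * c) * sqrt (n m * p m)) at_top sequentially"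
    using c by (intro filterlim_tendsto_pos_mult_at_top[OF tendsto_const]) simp_all
  then have "filterlim (\<lambda>m. - (2 * sqrt (n m * p m) * c)) at_bot sequentially"
    by (simp add: filterlim_uminus_at_top mult_ac)
  then show ?thesis
    by (rule filterlim_compose[OF exp_at_bot])
qed

theorem proposition3p4:
  fixes n p :: "nat \<Rightarrow> nat"
    and c0 c1 \<alpha> :: real
    and K :: nat
    and \<Theta> :: "nat \<Rightarrow> real mat set"
    and t :: "nat \<Rightarrow> real"
    and M :: "nat \<Rightarrow> 'w measure"
    and N :: "nat \<Rightarrow> 'w \<Rightarrow> real mat"
    and G :: "nat \<Rightarrow> nat \<Rightarrow> 'w \<Rightarrow> nat \<Rightarrow> real mat"
  assumes level: "0 < \<alpha>" "\<alpha> \<le> 1"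
    and draws: "1 \<le> K" "1 / (real K + 1) \<le> \<alpha>"
    and dims_at_top: "filterlim n at_top sequentially" "filterlim p at_top sequentially"
    and constants: "0 < c0" "c0 < c1"
    and ratio: "\<And>m. m \<ge> 1 \<Longrightarrow> c0 \<le> real (n m) / real (p m) \<and> real (n m) / real (p m) \<le> c1"
    and alternatives: "\<And>m. m \<ge> 1 \<Longrightarrow> \<Theta> m \<subseteq> carrier_mat (n m) (p m)"
    and prob: "\<And>m. m \<ge> 1 \<Longrightarrow> prob_space (M m)"
    and noise: "\<And>m. m \<ge> 1 \<Longrightarrow> N m \<in> M m \<rightarrow>\<^sub>M mat_borel (n m) (p m)"
    and columns_indep: "\<And>m. m \<ge> 1 \<Longrightarrow>
      prob_space.indep_vars (M m) (\<lambda>_. vec_borel (n m)) (\<lambda>j \<omega>. col (N m \<omega>) j) {..<p m}"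
    and columns_spherical: "\<And>m j. m \<ge> 1 \<Longrightarrow> j < p m \<Longrightarrow>
      spherical (M m) (n m) (\<lambda>\<omega>. col (N m \<omega>) j)"
    and group_haar: "\<And>m k. m \<ge> 1 \<Longrightarrow> k \<in> {1..K} \<Longrightarrow>
      haar_prob_measure (column_rotations (n m) (p m)) (column_rotations_borel (n m) (p m))
        (distr (M m) (column_rotations_borel (n m) (p m)) (G m k))"
    and group_indep: "\<And>m. m \<ge> 1 \<Longrightarrow>
      prob_space.indep_vars (M m) (\<lambda>_. column_rotations_borel (n m) (p m)) (G m) {1..K}"
    and group_noise_indep: "\<And>m. m \<ge> 1 \<Longrightarrow>
      indep_rvs (M m)
        (mat_borel (n m) (p m)) (N m)
        (\<Pi>\<^sub>M k\<in>{1..K}. column_rotations_borel (n m) (p m)) (\<lambda>\<omega>. \<lambda>k\<in>{1..K}. G m k \<omega>)"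
    and noise_bound:
      "(\<lambda>m. measure (M m) {\<omega> \<in> space (M m). two_inf_norm (N m \<omega>) \<le> t m}) \<longlonglongrightarrow> 1"
    and signal: "\<And>s. (\<forall>m\<ge>1. s m \<in> \<Theta> m) \<Longrightarrow>
      liminf (\<lambda>m. ereal
        ((op_norm (s m) / (sqrt (real (n m)) + sqrt (real (p m)))) /
         ((two_inf_norm (s m) + 2 * t m) / sqrt (real (n m))))) > 2"
  shows "consistent_against
    (\<lambda>m s. measure (M m) {\<omega> \<in> space (M m).
       randomization_rejects op_norm (rotate_columns (n m) (p m)) \<alpha> K (s + N m \<omega>) (\<lambda>k. G m k \<omega>)})
    \<Theta>"
  unfolding consistent_against_def
proof (intro allI impI)
  fix s assume s: "\<forall>m\<ge>1. s m \<in> \<Theta> m"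
  define R where "R m = op_norm (s m) / (sqrt (real (n m)) + sqrt (real (p m))) /
         ((two_inf_norm (s m) + 2 * t m) / sqrt (real (n m)))" for m
  define E where "E m = measure (M m) {\<omega> \<in> space (M m). two_inf_norm (N m \<omega>) \<le> t m}" for m
  define rej where "rej m = measure (M m) {\<omega> \<in> space (M m).
       randomization_rejects op_norm (rotate_columns (n m) (p m)) \<alpha> K (s m + N m \<omega>) (\<lambda>k. G m k \<omega>)}" for m
  have "2 < liminf (\<lambda>m. ereal (R m))"
    unfolding R_def by (rule signal[OF s])
  \<comment> \<open>A constant strictly between 2 and the lower limit turns the asymptotic condition
    into a fixed margin \<gamma> = c - 2, valid for all large \<open>m\<close>.\<close>
  then obtain c where c: "2 < ereal c" "ereal c < liminf (\<lambda>m. ereal (R m))"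
    using ereal_dense2 by blast
  define \<gamma> where "\<gamma> = c - 2"
  have \<gamma>: "0 < \<gamma>" using c(1) by (simp add: \<gamma>_def)
  have ev_R: "\<forall>\<^sub>F m in sequentially. 2 + \<gamma> < R m"
    using less_LiminfD[OF c(2)] by (simp add: \<gamma>_def)
  \<comment> \<open>Positivity of the probability of the noise bound yields t m \<ge> 0 in the bound
    at fixed size.\<close>
  have ev_E: "\<forall>\<^sub>F m in sequentially. 0 < E m"
    using order_tendstoD(1)[OF noise_bound, of 0] by (simp add: E_def)
  have ev_n: "\<forall>\<^sub>F m in sequentially. 0 < n m" and ev_p: "\<forall>\<^sub>F m in sequentially. 0 < p m"
    using dims_at_top by (auto intro: eventually_compose_filterlim[OF eventually_gt_at_top])
  have lower: "\<forall>\<^sub>F m in sequentially. E m - (real K + 1) * exp (- (2 * sqrt (n m * p m) * \<gamma>)) \<le> rej m"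
    using ev_R ev_E ev_n ev_p eventually_ge_at_top[of 1]
  proof eventually_elim
    case (elim m)
    show ?case
      unfolding E_def rej_def
    proof (rule rejection_probability_ge)
      show "s m \<in> carrier_mat (n m) (p m)" using s alternatives elim by blast
    qed (use elim \<gamma> draws prob noise columns_indep columns_spherical group_haar group_noise_indep
        in \<open>simp_all add: R_def E_def less_imp_le\<close>)
  qed
  have upper: "\<forall>\<^sub>F m in sequentially. rej m \<le> 1"
    using eventually_ge_at_top[of 1]
  proof eventually_elim
    case (elim m)
    then show ?case unfolding rej_def by (intro prob_space.prob_le_1 prob)
  qed
  \<comment> \<open>\<open>K\<close> and \<gamma> do not depend on \<open>m\<close>, so the error
    term vanishes as the dimensions grow, and the rejection probability is squeezed between a
    sequence tending to 1 and 1.\<close>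
  have "(\<lambda>m. E m - (real K + 1) * exp (- (2 * sqrt (n m * p m) * \<gamma>))) \<longlonglongrightarrow> 1 - (real K + 1) * 0"
    unfolding E_def by (intro tendsto_diff tendsto_mult tendsto_const noise_bound exp_neg_sqrt_tendsto_0 dims_at_top \<gamma>)
  then have "rej \<longlonglongrightarrow> 1"
    by (intro tendsto_sandwich[OF lower upper]) simp_all
  then show "(\<lambda>m. measure (M m) {\<omega> \<in> space (M m).
       randomization_rejects op_norm (rotate_columns (n m) (p m)) \<alpha> K (s m + N m \<omega>) (\<lambda>k. G m k \<omega>)}) \<longlonglongrightarrow> 1"
    unfolding rej_def .
qed

end
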